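(* The CAPCAB can be solved in polynomial time if the compensation and acceptance decisions are separable and optimal compensation values $C^*_{ij}$ for tasks $i\in I$ and occasional drivers $j\in J$ can be identified in polynomial time.
   Context: An instance of the Crowdshipping Assignment Problem with Compensation-Driven Acceptance Behavior (CAPCAB) consists of a finite set $I$ of tasks, a finite set $J$ of occasional drivers, costs $c_i'\ge c_i\ge 0$ for each $i\in I$ ($c_i$ is the cost of having task $i$ performed by a professional driver, $c_i'$ the penalized cost incurred if task $i$ is refused by an occasional driver), and, for each $i\in I$, $j\in J$, an acceptance probability function $P_{ij}:[0,\infty)\to[0,1]$ with $P_{ij}(0)=0$, where $P_{ij}(C_{ij})$ is the probability that driver $j$ accepts task $i$ when offered compensation $C_{ij}$. A feasible solution consists of a one-to-one assignment $A\subseteq I\times J$ of offered pairs (each task and each driver occurs in at most one pair of $A$) and compensations $C_{ij}\ge 0$. Let $I_{\mathrm o}=\{i : (i,j)\in A \text{ for some } j\}$. The expected total cost of the solution is $$\sum_{i\in I\setminus I_{\mathrm o}} c_i+\sum_{(i,j)\in A}\bigl(P_{ij}(C_{ij})\,C_{ij}+(1-P_{ij}(C_{ij}))\,c_i'\bigr).$$ Solving the CAPCAB means finding a feasible solution of minimum expected total cost. Compensation and acceptance decisions are separable when the acceptance probability functions are independent of each other for each pair of task and occasional driver (the probability that $j$ accepts $i$ does not depend on other tasks, on compensations offered to other drivers, or on their acceptance decisions) and there are no constraints that limit the operator's choice, such as cardinality or budget limits on the tasks offered to occasional drivers. The optimal compensation values are $C^*_{ij}=\operatorname{argmin}_{C_{ij}\ge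 0}P_{ij}(C_{ij})(C_{ij}-c_i')$.
   Formalization: The formal theorem additionally assumes that the acceptance probabilities P_ij can be evaluated in polynomial time at optimal compensation values; without such access to P_ij the claim fails, since the optimal assignment can depend on P_ij(C*_ij) even when C*_ij is known. *)

theory Defs
  imports
    "HOL-Probability.Probability"
    "HOL-Computational_Algebra.Polynomial"
    "HOL-Library.Log_Nat"
begin

section \<open>Instances and solutions\<close>

text \<open>
  A solution consists of a set \<open>A\<close> of offered (task, driver) pairs and compensations \<open>C\<close>.
  The fields \<open>law\<close> and \<open>admissible\<close> leave room for instances that are not separable:
  \<open>law X A C\<close> is the joint distribution of the set of accepted offers when the
  operator makes the offers \<open>A\<close> with compensations \<open>C\<close>, and \<open>admissible X A C\<close> are the
  side constraints (cardinality, budget, \<dots>) on the operator's choice. In a separable instance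
  both are determined by the remaining fields.
\<close>

type_synonym offers = "(nat \<times> nat) set"
type_synonym compensations = "nat \<Rightarrow> nat \<Rightarrow> real"

record capcab =
  tasks :: "nat set"
  drivers :: "nat set"
  cost :: "nat \<Rightarrow> real"
  penalized_cost :: "nat \<Rightarrow> real"
  acceptance :: "nat \<Rightarrow> nat \<Rightarrow> real \<Rightarrow> real"
  law :: "offers \<Rightarrow> compensations \<Rightarrow> offers pmf"
  admissible :: "offers \<Rightarrow> compensations \<Rightarrow> bool"

definition capcab_instance :: "capcab \<Rightarrow> bool" where
  "capcab_instance X \<longleftrightarrow>
     finite (tasks X) \<and> finite (drivers X) \<and>
     (\<forall>i\<in>tasks X. 0 \<le> cost X i \<and> cost X i \<le> penalized_cost X i) \<and>
     (\<forall>i\<in>tasks X. \<forall>j\<in>drivers X. acceptance X i j 0 = 0 \<and>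
        (\<forall>x\<ge>0. 0 \<le> acceptance X i j x \<and> acceptance X i j x \<le> 1)) \<and>
     (\<forall>A C. set_pmf (law X A C) \<subseteq> Pow A)"

definition is_assignment :: "capcab \<Rightarrow> offers \<Rightarrow> bool" where
  "is_assignment X A \<longleftrightarrow> A \<subseteq> tasks X \<times> drivers X \<and> inj_on fst A \<and> inj_on snd A"

definition is_solution :: "capcab \<Rightarrow> offers \<Rightarrow> compensations \<Rightarrow> bool" where
  "is_solution X A C \<longleftrightarrow> is_assignment X A \<and> (\<forall>(i, j)\<in>A. 0 \<le> C i j)"

definition feasible :: "capcab \<Rightarrow> offers \<Rightarrow> compensations \<Rightarrow> bool" where
  "feasible X A C \<longleftrightarrow> is_solution X A C \<and> admissible X A C"

definition acceptance_prob :: "capcab \<Rightarrow> offers \<Rightarrow> compensations \<Rightarrow> nat \<Rightarrow> nat \<Rightarrow> real" where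
  "acceptance_prob X A C i j = measure_pmf.prob (law X A C) {S. (i, j) \<in> S}"

definition expected_cost :: "capcab \<Rightarrow> offers \<Rightarrow> compensations \<Rightarrow> real" where
  "expected_cost X A C =
     (\<Sum>i\<in>tasks X - fst ` A. cost X i) +
     (\<Sum>(i, j)\<in>A. acceptance_prob X A C i j * C i j +
                  (1 - acceptance_prob X A C i j) * penalized_cost X i)"

definition optimal :: "capcab \<Rightarrow> offers \<Rightarrow> compensations \<Rightarrow> bool" where
  "optimal X A C \<longleftrightarrow>
     is_arg_min (\<lambda>(A, C). expected_cost X A C) (\<lambda>(A, C). feasible X A C) (A, C)"

text \<open>
  The first condition says that, given the decisions \<open>T\<close> on all other offers, the offer \<open>(i, j)\<close>
  is accepted with conditional probability \<open>P\<^sub>i\<^sub>j(C\<^sub>i\<^sub>j)\<close>, whatever \<open>A\<close>, \<open>T\<close> and the other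
  compensations are; it is multiplied out so as to make sense for null events.
\<close>

definition separable :: "capcab \<Rightarrow> bool" where
  "separable X \<longleftrightarrow>
     (\<forall>A C. is_solution X A C \<longrightarrow>
        (\<forall>(i, j)\<in>A. \<forall>T \<subseteq> A - {(i, j)}.
           measure_pmf.prob (law X A C) {S. (i, j) \<in> S \<and> S - {(i, j)} = T} =
           acceptance X i j (C i j) * measure_pmf.prob (law X A C) {S. S - {(i, j)} = T})) \<and>
     (\<forall>A C. is_solution X A C \<longrightarrow> admissible X A C)"

definition optimal_compensation :: "capcab \<Rightarrow> nat \<Rightarrow> nat \<Rightarrow> real \<Rightarrow> bool" where
  "optimal_compensation X i j x \<longleftrightarrow>
     is_arg_min (\<lambda>y. acceptance X i j y * (y - penalized_cost X i)) (\<lambda>y. 0 \<le> y) x"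


section \<open>Polynomial time\<close>

text \<open>
  Programs are those of a WHILE language over binary trees in the style of Jones, written without
  variables, with numbers at the leaves. Two standard cost models are covered.
  With \<open>Bit_Cost\<close> all numbers are rational and each number handled costs its binary length; this
  is polynomially equivalent to Turing machines. With \<open>Unit_Cost F\<close> the language is a real RAM
  in which each operation has cost 1 and the functions \<open>F k\<close> are available as
  additional primitives (such as the exponential function or Lambert's W; one may
  take \<open>F k = id\<close> to have none). Trees may share subtrees, so copying has cost 1.
\<close>

datatype cost_model = Unit_Cost "nat \<Rightarrow> real \<Rightarrow> real" | Bit_Cost

definition bit_size :: "rat \<Rightarrow> nat" where
  "bit_size r = (case quotient_of r of (p, q) \<Rightarrow> floorlog 2 (nat \<bar>p\<bar>) + floorlog 2 (nat q))"

fun number_size :: "cost_model \<Rightarrow> real \<Rightarrow> nat" where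
  "number_size (Unit_Cost F) x = 1"
| "number_size Bit_Cost x = bit_size (inv real_of_rat x)"

fun numbers :: "cost_model \<Rightarrow> real set" where
  "numbers (Unit_Cost F) = UNIV"
| "numbers Bit_Cost = \<rat>"

datatype val = VNil | VNum real | VPair val val

primrec val_size :: "cost_model \<Rightarrow> val \<Rightarrow> nat" where
  "val_size m VNil = 1"
| "val_size m (VNum x) = 1 + number_size m x"
| "val_size m (VPair v w) = 1 + val_size m v + val_size m w"

primrec val_numbers :: "val \<Rightarrow> real set" where
  "val_numbers VNil = {}"
| "val_numbers (VNum x) = {x}"
| "val_numbers (VPair v w) = val_numbers v \<union> val_numbers w"

datatype basic =
    Copy | Empty | Lit int | Head | Tail | Is_Num | Plus | Minus | Times | Divide | Less | Prim nat

text \<open>Truth values are represented by \<open>VNil\<close> (false) and any other value (true).\<close>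

definition vbool :: "bool \<Rightarrow> val" where
  "vbool b = (if b then VNum 1 else VNil)"

fun binary :: "(real \<Rightarrow> real \<Rightarrow> val) \<Rightarrow> val \<Rightarrow> val" where
  "binary f (VPair (VNum x) (VNum y)) = f x y"
| "binary f _ = VNil"

fun apply_basic :: "cost_model \<Rightarrow> basic \<Rightarrow> val \<Rightarrow> val" where
  "apply_basic m Copy v = v"
| "apply_basic m Empty v = VNil"
| "apply_basic m (Lit k) v = VNum (of_int k)"
| "apply_basic m Head v = (case v of VPair a b \<Rightarrow> a | _ \<Rightarrow> VNil)"
| "apply_basic m Tail v = (case v of VPair a b \<Rightarrow> b | _ \<Rightarrow> VNil)"
| "apply_basic m Is_Num v = vbool (case v of VNum x \<Rightarrow> True | _ \<Rightarrow> False)"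
| "apply_basic m Plus v = binary (\<lambda>x y. VNum (x + y)) v"
| "apply_basic m Minus v = binary (\<lambda>x y. VNum (x - y)) v"
| "apply_basic m Times v = binary (\<lambda>x y. VNum (x * y)) v"
| "apply_basic m Divide v = binary (\<lambda>x y. VNum (x / y)) v"
| "apply_basic m Less v = binary (\<lambda>x y. vbool (x < y)) v"
| "apply_basic m (Prim k) v =
     (case (m, v) of (Unit_Cost F, VNum x) \<Rightarrow> VNum (F k x) | _ \<Rightarrow> VNil)"

text \<open>A basic operation is charged for the numbers it can see in its argument and its result.\<close>

fun visible_size :: "cost_model \<Rightarrow> val \<Rightarrow> nat" where
  "visible_size m (VNum x) = number_size m x"
| "visible_size m (VPair (VNum x) (VNum y)) = number_size m x + number_size m y"
| "visible_size m _ = 0"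

definition basic_time :: "cost_model \<Rightarrow> basic \<Rightarrow> val \<Rightarrow> nat" where
  "basic_time m b v = 1 + visible_size m v + visible_size m (apply_basic m b v)"

datatype prog =
    Basic basic
  | Seq prog prog
  | Fork prog prog
  | If prog prog prog
  | While prog prog

text \<open>\<open>runs m p v w t\<close>: program \<open>p\<close> started on \<open>v\<close> halts with result \<open>w\<close> after time \<open>t\<close>.\<close>

inductive runs :: "cost_model \<Rightarrow> prog \<Rightarrow> val \<Rightarrow> val \<Rightarrow> nat \<Rightarrow> bool" for m where
  Basic: "runs m (Basic b) v (apply_basic m b v) (basic_time m b v)"
| Seq: "runs m p u v s \<Longrightarrow> runs m q v w t \<Longrightarrow> runs m (Seq p q) u w (1 + s + t)"
| Fork: "runs m p u v s \<Longrightarrow> runs m q u w t \<Longrightarrow> runs m (Fork p q) u (VPair v w) (1 + s + t)"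
| If_True: "runs m b u v s \<Longrightarrow> v \<noteq> VNil \<Longrightarrow> runs m p u w t \<Longrightarrow> runs m (If b p q) u w (1 + s + t)"
| If_False: "runs m b u VNil s \<Longrightarrow> runs m q u w t \<Longrightarrow> runs m (If b p q) u w (1 + s + t)"
| While_True: "runs m b u v s \<Longrightarrow> v \<noteq> VNil \<Longrightarrow> runs m p u u' t \<Longrightarrow>
    runs m (While b p) u' w r \<Longrightarrow> runs m (While b p) u w (1 + s + t + r)"
| While_False: "runs m b u VNil s \<Longrightarrow> runs m (While b p) u u (1 + s)"

inductive_cases runs_BasicE: "runs m (Basic b) v w t"
inductive_cases runs_SeqE: "runs m (Seq p q) v w t"
inductive_cases runs_ForkE: "runs m (Fork p q) v w t"
inductive_cases runs_IfE: "runs m (If b p q) v w t"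
inductive_cases runs_WhileE: "runs m (While b p) v w t"

lemma runs_deterministic:
  assumes "runs m p v w t" "runs m p v w' t'"
  shows "w' = w \<and> t' = t"
  using assms
proof (induction arbitrary: w' t' rule: runs.induct)
  case (Basic b v)
  then show ?case by (auto elim: runs_BasicE)
next
  case (Seq p u v s q w t)
  from Seq.prems show ?case by (rule runs_SeqE) (auto dest!: Seq.IH)
next
  case (Fork p u v s q w t)
  from Fork.prems show ?case by (rule runs_ForkE) (auto dest!: Fork.IH)
next
  case (If_True b u v s p w t q)
  from If_True.prems show ?case by (rule runs_IfE) (use If_True.hyps in \<open>auto dest!: If_True.IH\<close>)
next
  case (If_False b u s q w t p)
  from If_False.prems show ?case by (rule runs_IfE) (use If_False.hyps in \<open>auto dest!: If_False.IH\<close>)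
next
  case (While_True b u v s p u' t w r)
  from While_True.prems show ?case
    by (rule runs_WhileE) (use While_True.hyps in \<open>auto dest!: While_True.IH\<close>)
next
  case (While_False b u s p)
  from While_False.prems show ?case
    by (rule runs_WhileE) (use While_False.hyps in \<open>auto dest!: While_False.IH\<close>)
qed

text \<open>
  Polynomial-time solvability of a search problem: \<open>enc x\<close> is the input belonging to the problem
  instance \<open>x \<in> D\<close> and \<open>R x w\<close> says that \<open>w\<close> is a correct output. The size of the output is
  counted as well, since shared subtrees have to be written out.
\<close>

definition poly_time :: "cost_model \<Rightarrow> 'a set \<Rightarrow> ('a \<Rightarrow> val) \<Rightarrow> ('a \<Rightarrow> val \<Rightarrow> bool) \<Rightarrow> bool" where
  "poly_time m D enc R \<longleftrightarrow>
     (\<exists>(p :: prog) (b :: nat poly). \<forall>x\<in>D. \<exists>w t.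
        runs m p (enc x) w t \<and> t + val_size m w \<le> poly b (val_size m (enc x)) \<and> R x w)"


section \<open>Encodings\<close>

primrec vlist :: "val list \<Rightarrow> val" where
  "vlist [] = VNil"
| "vlist (v # vs) = VPair v (vlist vs)"

abbreviation vnat :: "nat \<Rightarrow> val" where
  "vnat n \<equiv> VNum (real n)"

text \<open>
  The acceptance probability functions are given to a program by some description \<open>d\<close> (for
  instance, a list of the parameters of all \<open>P\<^sub>i\<^sub>j\<close>). A class of CAPCAB instances is a set of pairs
  \<open>(X, d)\<close>; how \<open>d\<close> describes the functions depends on the class only.
\<close>

definition enc_instance :: "capcab \<times> val \<Rightarrow> val" where
  "enc_instance = (\<lambda>(X, d). vlist
     [vlist (map (\<lambda>i. vlist [vnat i, VNum (cost X i), VNum (penalized_cost X i)])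
               (sorted_list_of_set (tasks X))),
      vlist (map vnat (sorted_list_of_set (drivers X))),
      d])"

definition instance_class :: "cost_model \<Rightarrow> (capcab \<times> val) set \<Rightarrow> bool" where
  "instance_class m K \<longleftrightarrow>
     (\<forall>(X, d)\<in>K. capcab_instance X \<and> val_numbers (enc_instance (X, d)) \<subseteq> numbers m)"

definition encodes_solution :: "val \<Rightarrow> offers \<Rightarrow> compensations \<Rightarrow> bool" where
  "encodes_solution w A C \<longleftrightarrow>
     (\<exists>os. w = vlist (map (\<lambda>(i, j). vlist [vnat i, vnat j, VNum (C i j)]) os) \<and> set os = A)"

definition capcab_poly_time :: "cost_model \<Rightarrow> (capcab \<times> val) set \<Rightarrow> bool" where
  "capcab_poly_time m K \<longleftrightarrow>
     poly_time m K enc_instance (\<lambda>(X, d) w. \<exists>A C. encodes_solution w A C \<and> optimal X A C)"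

definition optimal_compensations_poly_time :: "cost_model \<Rightarrow> (capcab \<times> val) set \<Rightarrow> bool" where
  "optimal_compensations_poly_time m K \<longleftrightarrow>
     poly_time m
       {((X, d), i, j) | X d i j. (X, d) \<in> K \<and> i \<in> tasks X \<and> j \<in> drivers X}
       (\<lambda>(Xd, i, j). vlist [enc_instance Xd, vnat i, vnat j])
       (\<lambda>((X, d), i, j) w. \<exists>x. w = VNum x \<and> optimal_compensation X i j x)"

text \<open>
  The functions \<open>P\<^sub>i\<^sub>j\<close> belong to the input, so that it must be possible to evaluate them. This is
  required at optimal compensation values only.
\<close>

definition acceptance_poly_time :: "cost_model \<Rightarrow> (capcab \<times> val) set \<Rightarrow> bool" where
  "acceptance_poly_time m K \<longleftrightarrow>
     poly_time m
       {((X, d), i, j, x) | X d i j x. (X, d) \<in> K \<and> i \<in> tasks X \<and> j \<in> drivers X \<and>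
          x \<in> numbers m \<and> optimal_compensation X i j x}
       (\<lambda>(Xd, i, j, x). vlist [enc_instance Xd, vnat i, vnat j, VNum x])
       (\<lambda>((X, d), i, j, x) w. w = VNum (acceptance X i j x))"


section \<open>The expected cost in the separable case\<close>

lemma separable_acceptance_prob:
  assumes "capcab_instance X" "separable X" "is_solution X A C" "(i, j) \<in> A"
  shows "acceptance_prob X A C i j = acceptance X i j (C i j)"
proof -
  let ?M = "law X A C" and ?B = "A - {(i, j)}"
  have "A \<subseteq> tasks X \<times> drivers X" "finite (tasks X \<times> drivers X)"
    using assms(1,3) by (simp_all add: capcab_instance_def is_solution_def is_assignment_def)
  then have finA: "finite A"
    by (rule finite_subset)
  have sup: "set_pmf ?M \<subseteq> Pow A"
    using assms(1) by (simp add: capcab_instance_def)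
  have sep: "measure_pmf.prob ?M {S. (i, j) \<in> S \<and> S - {(i, j)} = T} =
      acceptance X i j (C i j) * measure_pmf.prob ?M {S. S - {(i, j)} = T}" if "T \<in> Pow ?B" for T
    using assms(2-4) that unfolding separable_def by blast
  have part: "measure_pmf.prob ?M Q = (\<Sum>T\<in>Pow ?B. measure_pmf.prob ?M {S\<in>Q. S - {(i, j)} = T})" for Q
  proof -
    have "measure_pmf.prob ?M Q = measure_pmf.prob ?M (\<Union>T\<in>Pow ?B. {S\<in>Q. S - {(i, j)} = T})"
      by (rule measure_prob_cong_0) (use sup in \<open>auto simp: set_pmf_iff\<close>)
    also have "\<dots> = (\<Sum>T\<in>Pow ?B. measure_pmf.prob ?M {S\<in>Q. S - {(i, j)} = T})"
      by (rule measure_pmf.finite_measure_finite_Union) (use finA in \<open>auto simp: disjoint_family_on_def\<close>)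
    finally show ?thesis .
  qed
  have "acceptance_prob X A C i j =
      (\<Sum>T\<in>Pow ?B. measure_pmf.prob ?M {S. (i, j) \<in> S \<and> S - {(i, j)} = T})"
    unfolding acceptance_prob_def by (subst part) simp
  also have "\<dots> = acceptance X i j (C i j) * (\<Sum>T\<in>Pow ?B. measure_pmf.prob ?M {S. S - {(i, j)} = T})"
    by (simp add: sep sum_distrib_left del: Pow_iff)
  also have "(\<Sum>T\<in>Pow ?B. measure_pmf.prob ?M {S. S - {(i, j)} = T}) = 1"
    using part[of UNIV] by simp
  finally show ?thesis by simp
qed

lemma separable_expected_cost:
  assumes "capcab_instance X" "separable X" "is_solution X A C"
  shows "expected_cost X A C =
     (\<Sum>i\<in>tasks X - fst ` A. cost X i) +
     (\<Sum>(i, j)\<in>A. acceptance X i j (C i j) * C i j +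
                  (1 - acceptance X i j (C i j)) * penalized_cost X i)"
  unfolding expected_cost_def
  by (auto intro!: sum.cong simp: separable_acceptance_prob[OF assms])

end

theory Submission
  imports Defs
begin

text \<open>
  In a separable instance the expected cost is a sum over the tasks, so that each offer should be
  made with its optimal compensation, and what remains is a weighted bipartite assignment of tasks
  to drivers, with a professional driver as an additional option for each task. The tasks are
  inserted one at a time along a cheapest augmenting path, found by the Bellman-Ford algorithm; the
  path lengths yield a new feasible dual solution, which certifies optimality but is never computed.
  In the bit model it is essential that every distance is the cost of a simple alternating path:
  it is a sum of linearly many weights with signs, so that its size is polynomial.
\<close>

section \<open>Augmenting paths and dual certificates\<close>

text \<open>An offer costs c' + P(C) (C - c'), so its best compensation does not depend on the rest
  of the solution. Each row of weights is computed once, when its task is inserted, with one call of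
  either given program per task and driver. Search with reduced costs would need the dual values in
  the program state, and in the bit model their sizes would have to be controlled over all
  insertions. Bellman-Ford copes with the arc lengths \<open>W i k' - W i k\<close>, which may be
  negative, and starts afresh from the original weights and the matching alone; the dual solution
  occurs only in proofs, where it excludes negative cycles and shows optimality. Sizes and running
  times are kept apart: a number is measured by how many input numbers it is built from
  (\<open>fits\<close>), and \<open>steps\<close> counts operations under one bound \<open>B\<close>
  on the size of all numbers.\<close>

text \<open>
  Rows are assigned to columns at cost \<open>W\<close>; \<open>own k\<close> is the row that owns column \<open>k\<close>.
  A path is listed from its last column back to the first one. The new row \<open>r\<close> takes the first
  column, and the owner of each column moves on to the next column of the path.
\<close>

fun path_cost :: "('r \<Rightarrow> 'c \<Rightarrow> real) \<Rightarrow> ('c \<rightharpoonup> 'r) \<Rightarrow> 'r \<Rightarrow> 'c list \<Rightarrow> real" where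
  "path_cost W own r [] = 0"
| "path_cost W own r [x] = W r x"
| "path_cost W own r (x # y # p) = path_cost W own r (y # p) - W (the (own y)) y + W (the (own y)) x"

fun moves :: "('c \<rightharpoonup> 'r) \<Rightarrow> 'r \<Rightarrow> 'c list \<Rightarrow> ('c \<times> 'r) list" where
  "moves own r [] = []"
| "moves own r [x] = [(x, r)]"
| "moves own r (x # y # p) = (x, the (own y)) # moves own r (y # p)"

definition alt_path :: "'c set \<Rightarrow> ('c \<rightharpoonup> 'r) \<Rightarrow> 'c list \<Rightarrow> bool" where
  "alt_path cols own p \<longleftrightarrow> p \<noteq> [] \<and> set p \<subseteq> cols \<and> set (tl p) \<subseteq> dom own"

definition owners :: "'c set \<Rightarrow> 'r set \<Rightarrow> ('c \<rightharpoonup> 'r) \<Rightarrow> bool" where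
  "owners cols R own \<longleftrightarrow> dom own \<subseteq> cols \<and> inj_on own (dom own) \<and> ran own = R"

text \<open>
  In \<open>certified\<close>, \<open>v\<close> is the column part of a dual solution. The row part is determined by
  complementary slackness: \<open>u i = W i k - v k\<close> if \<open>i\<close> owns \<open>k\<close>.
\<close>

definition feasible_pot :: "('r \<Rightarrow> 'c \<Rightarrow> real) \<Rightarrow> 'c set \<Rightarrow> ('c \<rightharpoonup> 'r) \<Rightarrow> ('c \<Rightarrow> real) \<Rightarrow> bool" where
  "feasible_pot W cols own v \<longleftrightarrow> (\<forall>k i k'. own k = Some i \<longrightarrow> k' \<in> cols \<longrightarrow> v k' \<le> v k - W i k + W i k')"

definition certified :: "('r \<Rightarrow> 'c \<Rightarrow> real) \<Rightarrow> 'c set \<Rightarrow> 'r set \<Rightarrow> ('c \<rightharpoonup> 'r) \<Rightarrow> bool" where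
  "certified W cols R own \<longleftrightarrow> owners cols R own \<and>
     (\<exists>v. feasible_pot W cols own v \<and> (\<forall>k\<in>cols. v k \<le> 0) \<and> (\<forall>k\<in>cols - dom own. v k = 0))"

lemma certified_empty: "certified W cols {} Map.empty"
  by (auto simp: certified_def owners_def feasible_pot_def intro!: exI[of _ "\<lambda>_. 0"])

lemma alt_path_Cons: "alt_path cols own (x # y # p) \<longleftrightarrow> x \<in> cols \<and> y \<in> dom own \<and> alt_path cols own (y # p)"
  by (auto simp: alt_path_def)

lemma alt_path_suffix: "alt_path cols own (ys @ x # zs) \<Longrightarrow> alt_path cols own (x # zs)"
  by (cases ys) (auto simp: alt_path_def)

text \<open>The inequalities of a potential telescope along the path. As lists run backwards,
  \<open>ys\<close> is the part travelled after \<open>x\<close>; the part up to \<open>x\<close>,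
  and with it \<open>r\<close>, cancels. If the head of \<open>ys\<close> is \<open>x\<close> again,
  the left side vanishes and the cycle has nonnegative cost.\<close>

lemma feasible_pot_path:
  assumes "feasible_pot W cols own f" "alt_path cols own (ys @ x # zs)"
  shows "f (hd (ys @ [x])) - f x \<le> path_cost W own r (ys @ x # zs) - path_cost W own r (x # zs)"
  using assms(2)
proof (induction ys)
  case (Cons y ys)
  obtain a p where ap: "ys @ x # zs = a # p" "a = hd (ys @ [x])"
    by (cases ys) auto
  have path: "y \<in> cols" "a \<in> dom own" "alt_path cols own (ys @ x # zs)"
    using Cons.prems ap by (auto simp: alt_path_Cons)
  then obtain i where i: "own a = Some i" by auto
  have "f y \<le> f a - W i a + W i y"
    using assms(1) i path unfolding feasible_pot_def by blast
  then show ?case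
    using Cons.IH[OF path(3)] ap i by simp
qed simp

lemma feasible_pot_min:
  assumes "feasible_pot W cols own f" "feasible_pot W cols own g"
  shows "feasible_pot W cols own (\<lambda>k. min (f k) (g k))"
  using assms unfolding feasible_pot_def by (smt (verit))

lemma feasible_pot_shift: "feasible_pot W cols own f \<Longrightarrow> feasible_pot W cols own (\<lambda>k. f k - d)"
  unfolding feasible_pot_def by (smt (verit))

section \<open>Changing the owners along a path\<close>

lemma dom_moves: "fst ` set (moves own r p) = set p"
  by (induction own r p rule: moves.induct) auto

lemma map_fst_moves: "map fst (moves own r p) = p"
  by (induction own r p rule: moves.induct) auto

text \<open>One move of an augmentation: \<open>i\<close> is the only row without a column, takes
  \<open>x\<close>, and thereby displaces the previous owner of \<open>x\<close>, if there is
  one.\<close>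

lemma inj_ran_update:
  assumes "inj_on f (dom f)" "ran f = R - {i}" "i \<in> R"
  shows "inj_on (f(x \<mapsto> i)) (dom (f(x \<mapsto> i)))"
    and "ran (f(x \<mapsto> i)) = R - set_option (f x)"
proof -
  have i: "i \<notin> ran f" using assms by auto
  then show "inj_on (f(x \<mapsto> i)) (dom (f(x \<mapsto> i)))"
    using assms(1) by (fastforce simp: inj_on_def ran_def)
  have "a = x" if "f a = Some b" "f x = Some b" for a b
    using assms(1) that by (auto simp: inj_on_def dom_def)
  then have "b \<in> ran (f(x \<mapsto> i)) \<longleftrightarrow> b = i \<or> (b \<in> ran f \<and> f x \<noteq> Some b)" for b
    unfolding ran_def by auto (metis fun_upd_other)
  moreover have "f x \<noteq> Some i"
    using i by (auto simp: ran_def)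
  ultimately show "ran (f(x \<mapsto> i)) = R - set_option (f x)"
    using assms(2,3) by (auto simp: elem_set set_eq_iff)
qed

text \<open>Induction from the start of the path, that is, from the end of the list. After each
  suffix exactly the old owner of its head column is displaced; the range is stated with
  \<open>set_option\<close> so that it also covers the free column that ends the
  augmentation.\<close>

lemma moves_inj_ran:
  assumes "owners cols R own" "r \<notin> R" "alt_path cols own p" "distinct p"
  shows "inj_on (own ++ map_of (moves own r p)) (dom (own ++ map_of (moves own r p)))"
    and "ran (own ++ map_of (moves own r p)) = insert r R - set_option (own (hd p))"
proof -
  let ?f = "\<lambda>p. own ++ map_of (moves own r p)"
  have "inj_on (?f p) (dom (?f p)) \<and> ran (?f p) = insert r R - set_option (own (hd p))"
    using assms(3,4)
  proof (induction p rule: induct_list012)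
    case 1
    then show ?case by (simp add: alt_path_def)
  next
    case (2 x)
    have "inj_on own (dom own)" "ran own = insert r R - {r}"
      using assms(1,2) by (auto simp: owners_def)
    from inj_ran_update[OF this, of x]
    have "inj_on (own(x \<mapsto> r)) (dom (own(x \<mapsto> r)))" "ran (own(x \<mapsto> r)) = insert r R - set_option (own x)"
      by blast+
    moreover have "?f [x] = own(x \<mapsto> r)"
      by (auto simp: map_add_def)
    ultimately show ?case by (metis list.sel(1))
  next
    case (3 x y p)
    obtain i where i: "own y = Some i"
      using 3 by (auto simp: alt_path_Cons)
    have IH: "inj_on (?f (y # p)) (dom (?f (y # p)))" "ran (?f (y # p)) = insert r R - {i}"
      using 3 i by (simp_all add: alt_path_Cons)
    have "i \<in> insert r R"
      using assms(1) i by (auto simp: owners_def ran_def)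
    note upd = inj_ran_update[OF IH this, of x]
    have f: "?f (x # y # p) = (?f (y # p))(x \<mapsto> i)"
      using i by (auto simp: map_add_def)
    \<comment> \<open>Since the path is simple, the earlier moves have not touched \<open>x\<close>:
      the row displaced now is its original owner.\<close>
    have "map_of (moves own r (y # p)) x = None"
      using 3 by (simp add: map_of_eq_None_iff dom_moves)
    then have "?f (y # p) x = own x"
      by (simp add: map_add_def)
    with upd show ?case unfolding f by (metis list.sel(1))
  qed
  then show "inj_on (?f p) (dom (?f p))" "ran (?f p) = insert r R - set_option (own (hd p))"
    by auto
qed

lemma moves_cases:
  assumes "(k, i) \<in> set (moves own r p)"
  shows "(\<exists>ys. p = ys @ [k] \<and> i = r) \<or> (\<exists>ys y zs. p = ys @ k # y # zs \<and> i = the (own y))"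
  using assms
proof (induction own r p rule: moves.induct)
  case (3 own r x y p)
  show ?case
  proof (cases "(k, i) = (x, the (own y))")
    case True
    then have "x # y # p = [] @ k # y # p \<and> i = the (own y)" by simp
    then show ?thesis by blast
  next
    case False
    with 3 have "(\<exists>ys. y # p = ys @ [k] \<and> i = r) \<or> (\<exists>ys z zs. y # p = ys @ k # z # zs \<and> i = the (own z))"
      by auto
    then show ?thesis
      by (metis append_Cons)
  qed
qed auto

text \<open>
  The new potential is the minimum of the shifted distances and the old potential: the distances
  are tight along the path, and the old potential is needed to keep the values nonpositive.
\<close>

lemma certified_augment:
  assumes cert: "certified W cols R own" and r: "r \<notin> R"
    and D_row: "\<And>k. k \<in> cols \<Longrightarrow> D k \<le> W r k"
    and D_pot: "feasible_pot W cols own D"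
    and p: "alt_path cols own p" "distinct p" "hd p \<notin> dom own" "D (hd p) = path_cost W own r p"
    and D_min: "\<And>k. k \<in> cols - dom own \<Longrightarrow> D (hd p) \<le> D k"
  shows "certified W cols (insert r R) (own ++ map_of (moves own r p))"
proof -
  let ?own' = "own ++ map_of (moves own r p)"
  obtain v where v: "feasible_pot W cols own v" "\<And>k. k \<in> cols \<Longrightarrow> v k \<le> 0"
      "\<And>k. k \<in> cols - dom own \<Longrightarrow> v k = 0"
    and own: "owners cols R own"
    using cert unfolding certified_def by blast
  define d where "d = D (hd p)"
  define v' where "v' k = min (D k - d) (v k)" for k
  have pot: "feasible_pot W cols own v'"
    unfolding v'_def using feasible_pot_min[OF feasible_pot_shift[OF D_pot] v(1)] .
  have hd: "hd p \<in> cols"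
    using p(1) by (auto simp: alt_path_def)
  \<comment> \<open>Along the path both parts are bounded by the telescoped inequalities of
    \<open>D\<close>, and equality at \<open>hd p\<close> forces equality at every suffix. The old
    potential telescopes to \<open>D x - d <= v x\<close> because it is 0 at the free end, so the
    minimum is attained by the shifted distance.\<close>
  have tight: "D x = path_cost W own r (x # zs) \<and> v' x = D x - d" if ys: "p = ys @ x # zs" for ys x zs
  proof -
    have hdp: "hd (ys @ [x]) = hd p"
      using ys by (cases ys) auto
    have path: "alt_path cols own (ys @ x # zs)"
      using p(1) ys by simp
    have 1: "D (hd p) - D x \<le> path_cost W own r p - path_cost W own r (x # zs)"
      using feasible_pot_path[OF D_pot path, of r] ys hdp by simp
    obtain l zs' where l: "x # zs = zs' @ [l]"
      by (metis append_butlast_last_id list.distinct(1))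
    have path': "alt_path cols own (x # zs)"
      using alt_path_suffix[OF path] .
    then have "D (hd (zs' @ [l])) - D l \<le> path_cost W own r (zs' @ [l]) - path_cost W own r [l]"
      using feasible_pot_path[OF D_pot, of zs' l "[]" r] l by simp
    moreover have "hd (zs' @ [l]) = x"
      using l by (metis list.sel(1))
    moreover have "D l \<le> W r l"
      using path' l by (intro D_row) (auto simp: alt_path_def)
    ultimately have 2: "D x = path_cost W own r (x # zs)"
      using 1 p(4) l by simp
    have "v (hd p) - v x \<le> path_cost W own r p - path_cost W own r (x # zs)"
      using feasible_pot_path[OF v(1) path, of r] ys hdp by simp
    moreover have "v (hd p) = 0"
      using v(3) p(3) hd by blast
    ultimately have "D x - d \<le> v x"
      using 2 p(4) by (simp add: d_def)
    with 2 show ?thesis by (simp add: v'_def)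
  qed
  have "feasible_pot W cols ?own' v'"
    unfolding feasible_pot_def
  proof (intro allI impI)
    fix k i k' assume ki: "?own' k = Some i" and k': "k' \<in> cols"
    show "v' k' \<le> v' k - W i k + W i k'"
    proof (cases "map_of (moves own r p) k")
      case None
      then have "own k = Some i" using ki by (simp add: map_add_def)
      then show ?thesis using pot k' by (auto simp: feasible_pot_def)
    next
      case (Some i')
      then have "(k, i) \<in> set (moves own r p)"
        using ki map_of_SomeD by fastforce
      \<comment> \<open>For the new row the claim is \<open>D k' <= W r k'\<close> shifted by
        \<open>d\<close>. A row that moves from \<open>y\<close> to \<open>k\<close> keeps its row
        dual: by tightness \<open>v' k - W i k = v' y - W i y\<close>, so its inequalities are those
        of its old column.\<close>
      from moves_cases[OF this] show ?thesis
      proof (elim disjE exE conjE)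
        fix ys assume "p = ys @ [k]" "i = r"
        then show ?thesis
          using tight[of ys k "[]"] D_row[OF k'] by (auto simp: v'_def min_def)
      next
        fix ys y zs assume p': "p = ys @ k # y # zs" and i: "i = the (own y)"
        have y: "own y = Some i"
          using p(1) p' i by (cases ys) (auto simp: alt_path_def)
        have "v' k' \<le> v' y - W i y + W i k'"
          using pot k' y by (auto simp: feasible_pot_def)
        then show ?thesis
          using tight[of ys k "y # zs"] tight[of "ys @ [k]" y zs] p' i by simp
      qed
    qed
  qed
  moreover have "v' k \<le> 0" if "k \<in> cols" for k
    using v(2)[OF that] by (simp add: v'_def min_def)
  \<comment> \<open>\<open>hd p\<close> is a cheapest free column, so the shifted distance is
    nonnegative on free columns, where the old potential is 0.\<close>
  moreover have "v' k = 0" if "k \<in> cols - dom ?own'" for k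
    using v(3)[of k] D_min[of k] that by (auto simp: v'_def d_def)
  moreover have "owners cols (insert r R) ?own'"
  proof -
    have "own (hd p) = None" using p(3) by auto
    moreover have "dom ?own' \<subseteq> cols"
      using own p(1) by (auto simp: owners_def alt_path_def dom_map_of_conv_image_fst dom_moves)
    ultimately show ?thesis
      unfolding owners_def using moves_inj_ran[OF own r p(1,2)] by simp
  qed
  ultimately show ?thesis
    unfolding certified_def by (intro conjI exI[of _ v']) auto
qed

text \<open>Weak duality. Feasibility gives
  \<open>W i (f i) >= W i (g i) - v (g i) + v (f i)\<close> for each row. The values
  \<open>v (f i)\<close> sum to at least the sum of \<open>v\<close> over all columns, as
  \<open>v\<close> is nonpositive, and this equals the sum of the \<open>v (g i)\<close>, as
  \<open>v\<close> vanishes on free columns.\<close>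

lemma certified_optimal:
  assumes cert: "certified W cols R own" and fin: "finite cols" "finite R"
    and g: "\<And>i. i \<in> R \<Longrightarrow> own (g i) = Some i"
    and f: "inj_on f R" "f ` R \<subseteq> cols"
  shows "(\<Sum>i\<in>R. W i (g i)) \<le> (\<Sum>i\<in>R. W i (f i))"
proof -
  obtain v where v: "feasible_pot W cols own v" "\<And>k. k \<in> cols \<Longrightarrow> v k \<le> 0"
      "\<And>k. k \<in> cols - dom own \<Longrightarrow> v k = 0"
    and own: "owners cols R own"
    using cert unfolding certified_def by blast
  have gi: "inj_on g R"
    by (metis g inj_onI option.inject)
  have gd: "g ` R = dom own"
  proof
    show "dom own \<subseteq> g ` R"
    proof
      fix k assume "k \<in> dom own"
      then obtain i where i: "own k = Some i" by auto
      then have ir: "i \<in> R" using own by (auto simp: owners_def ran_def)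
      have "own (g i) = own k" using g[OF ir] i by simp
      then have "g i = k"
        using own i g[OF ir] by (auto simp: owners_def inj_on_def dom_def)
      then show "k \<in> g ` R" using ir by blast
    qed
  qed (use g in auto)
  have sub: "dom own \<subseteq> cols" using own by (simp add: owners_def)
  have "(\<Sum>i\<in>R. v (f i)) = (\<Sum>k\<in>f ` R. v k)"
    by (simp add: sum.reindex[OF f(1)])
  also have "\<dots> \<ge> (\<Sum>k\<in>cols. v k)"
  proof -
    have "(\<Sum>k\<in>cols. v k) = (\<Sum>k\<in>f ` R. v k) + (\<Sum>k\<in>cols - f ` R. v k)"
      using sum.subset_diff[OF f(2) fin(1)] by (simp add: add.commute)
    moreover have "(\<Sum>k\<in>cols - f ` R. v k) \<le> 0"
      using v(2) by (intro sum_nonpos) auto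
    ultimately show ?thesis by simp
  qed
  also have "(\<Sum>k\<in>cols. v k) = (\<Sum>k\<in>dom own. v k)"
    using v(3) fin(1) sub by (intro sum.mono_neutral_right) auto
  also have "\<dots> = (\<Sum>i\<in>R. v (g i))"
    unfolding gd[symmetric] by (simp add: sum.reindex[OF gi])
  finally have "(\<Sum>i\<in>R. v (g i)) \<le> (\<Sum>i\<in>R. v (f i))" .
  moreover have "(\<Sum>i\<in>R. v (f i)) \<le> (\<Sum>i\<in>R. v (g i) - W i (g i) + W i (f i))"
    using v(1) g f(2) by (intro sum_mono) (auto simp: feasible_pot_def)
  ultimately show ?thesis
    by (simp add: sum.distrib sum_subtractf)
qed

lemma owners_free_column:
  assumes "owners cols R own" "finite cols" "card R < card cols"
  shows "\<exists>k\<in>cols. k \<notin> dom own"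
proof (rule ccontr)
  assume "\<not> ?thesis"
  then have "dom own = cols" using assms(1) by (auto simp: owners_def)
  moreover have "bij_betw (\<lambda>k. the (own k)) (dom own) R"
    using assms(1) unfolding bij_betw_def owners_def ran_def inj_on_def
    by (auto simp: image_def dom_def)
  ultimately show False
    using assms(3) bij_betw_same_card by fastforce
qed

section \<open>Shortest alternating paths\<close>

text \<open>The state of Bellman-Ford after \<open>t\<close> rounds. The suffix clause is only an
  inequality, because a column inside \<open>P k\<close> may have been improved since
  \<open>P k\<close> was recorded; it rules out cycles in new paths. The last clause ranges over all
  walks, not just simple paths.\<close>

definition paths_inv :: "('r \<Rightarrow> 'c \<Rightarrow> real) \<Rightarrow> 'c set \<Rightarrow> ('c \<rightharpoonup> 'r) \<Rightarrow> 'r \<Rightarrow> nat \<Rightarrow> ('c \<Rightarrow> real) \<Rightarrow> ('c \<Rightarrow> 'c list) \<Rightarrow> bool" where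
  "paths_inv W cols own r t D P \<longleftrightarrow>
     (\<forall>k\<in>cols. alt_path cols own (P k) \<and> hd (P k) = k \<and> distinct (P k) \<and> D k = path_cost W own r (P k) \<and>
        (\<forall>ys x zs. P k = ys @ x # zs \<longrightarrow> D x \<le> path_cost W own r (x # zs))) \<and>
     (\<forall>p. alt_path cols own p \<longrightarrow> length p \<le> Suc t \<longrightarrow> D (hd p) \<le> path_cost W own r p)"

text \<open>A round in which the columns of \<open>S\<close> have already been used as sources.
  Candidates are formed from the old tables \<open>D\<close> and \<open>P\<close>, so the order of
  the sources does not matter. The strict \<open>D' k < D k\<close> contradicts the suffix clause of
  \<open>paths_inv\<close> when an extension would close a cycle.\<close>

definition relaxed :: "('r \<Rightarrow> 'c \<Rightarrow> real) \<Rightarrow> 'c set \<Rightarrow> ('c \<rightharpoonup> 'r) \<Rightarrow> ('c \<Rightarrow> real) \<Rightarrow> ('c \<Rightarrow> 'c list) \<Rightarrow>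
    'c set \<Rightarrow> ('c \<Rightarrow> real) \<Rightarrow> ('c \<Rightarrow> 'c list) \<Rightarrow> bool" where
  "relaxed W cols own D P S D' P' \<longleftrightarrow>
     (\<forall>k\<in>cols. D' k \<le> D k \<and>
        (\<forall>j\<in>S. \<forall>i. own j = Some i \<longrightarrow> D' k \<le> D j - W i j + W i k) \<and>
        (D' k = D k \<and> P' k = P k \<or>
         (\<exists>j\<in>cols. \<exists>i. own j = Some i \<and> D' k = D j - W i j + W i k \<and> D' k < D k \<and> P' k = k # P j)))"

lemma paths_inv_init: "paths_inv W cols own r 0 (W r) (\<lambda>k. [k])"
proof -
  have "W r (hd p) \<le> path_cost W own r p" if "alt_path cols own p" "length p \<le> Suc 0" for p
    using that by (cases p) (auto simp: alt_path_def)
  then show ?thesis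
    by (auto simp: paths_inv_def alt_path_def Cons_eq_append_conv)
qed

lemma relaxed_init: "relaxed W cols own D P {} D P"
  by (simp add: relaxed_def)

lemma relaxed_step_free:
  "relaxed W cols own D P S D' P' \<Longrightarrow> own j = None \<Longrightarrow> relaxed W cols own D P (insert j S) D' P'"
  unfolding relaxed_def by fastforce

lemma relaxed_step:
  assumes "relaxed W cols own D P S D' P'" "j \<in> cols" "own j = Some i"
  shows "relaxed W cols own D P (insert j S)
     (\<lambda>k. if D j - W i j + W i k < D' k then D j - W i j + W i k else D' k)
     (\<lambda>k. if D j - W i j + W i k < D' k then k # P j else P' k)"
  unfolding relaxed_def
proof (rule ballI, intro conjI)
  fix k assume k: "k \<in> cols"
  show "(if D j - W i j + W i k < D' k then D j - W i j + W i k else D' k) \<le> D k"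
    using assms(1) k unfolding relaxed_def by force
  show "\<forall>a\<in>insert j S. \<forall>ia. own a = Some ia \<longrightarrow>
       (if D j - W i j + W i k < D' k then D j - W i j + W i k else D' k) \<le> D a - W ia a + W ia k"
    using assms k unfolding relaxed_def by fastforce
  show "(if D j - W i j + W i k < D' k then D j - W i j + W i k else D' k) = D k \<and>
       (if D j - W i j + W i k < D' k then k # P j else P' k) = P k \<or>
       (\<exists>a\<in>cols. \<exists>ia. own a = Some ia \<and>
          (if D j - W i j + W i k < D' k then D j - W i j + W i k else D' k) = D a - W ia a + W ia k \<and>
          (if D j - W i j + W i k < D' k then D j - W i j + W i k else D' k) < D k \<and>
          (if D j - W i j + W i k < D' k then k # P j else P' k) = k # P a)"
  proof (cases "D j - W i j + W i k < D' k")
    case True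
    then have "D j - W i j + W i k < D k"
      using assms(1) k unfolding relaxed_def by force
    with True assms(2,3) show ?thesis by auto
  next
    case False
    then show ?thesis using assms(1) k unfolding relaxed_def by simp
  qed
qed

text \<open>
  An improvement cannot close a cycle: the suffix that starts at the repeated column is no more
  expensive, since cycles have nonnegative cost in the presence of a feasible potential.
\<close>

lemma paths_inv_step:
  assumes inv: "paths_inv W cols own r t D P" and rel: "relaxed W cols own D P cols D' P'"
    and v: "feasible_pot W cols own v"
  shows "paths_inv W cols own r (Suc t) D' P'"
  unfolding paths_inv_def
proof (intro conjI ballI)
  fix k assume k: "k \<in> cols"
  have le: "D' x \<le> D x" if "x \<in> cols" for x
    using rel that by (simp add: relaxed_def)
  have old: "alt_path cols own (P k)" "hd (P k) = k" "distinct (P k)" "D k = path_cost W own r (P k)"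
    "\<And>ys x zs. P k = ys @ x # zs \<Longrightarrow> D x \<le> path_cost W own r (x # zs)" if "k \<in> cols" for k
    using inv that by (auto simp: paths_inv_def)
  have set: "set (P k) \<subseteq> cols" if "k \<in> cols" for k
    using inv that by (auto simp: paths_inv_def alt_path_def)
  have "alt_path cols own (P' k) \<and> hd (P' k) = k \<and> distinct (P' k) \<and> D' k = path_cost W own r (P' k) \<and>
        (\<forall>ys x zs. P' k = ys @ x # zs \<longrightarrow> D' x \<le> path_cost W own r (x # zs))"
  proof (cases "D' k = D k \<and> P' k = P k")
    case True
    \<comment> \<open>A recorded path survives a round unchanged: distances only decrease, which
      preserves the bounds on its suffixes.\<close>
    have "D' x \<le> path_cost W own r (x # zs)" if "P k = ys @ x # zs" for ys x zs
      using old(5)[OF k that] le[of x] set[of k] that k by auto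
    with True old(1-4)[of k] k show ?thesis by auto
  next
    case False
    then obtain j i where j: "j \<in> cols" "own j = Some i" "D' k = D j - W i j + W i k" "D' k < D k" "P' k = k # P j"
      using rel k by (auto simp: relaxed_def)
    note pj = old[OF j(1)]
    obtain q where q: "P j = j # q"
      using pj(1,2) by (cases "P j") (auto simp: alt_path_def)
    have path: "alt_path cols own (k # P j)"
      using pj(1) q k j(2) by (auto simp: alt_path_def)
    have cost: "path_cost W own r (k # P j) = D' k"
      using pj(4) q j(2,3) by simp
    have "k \<notin> set (P j)"
    proof
      assume "k \<in> set (P j)"
      then obtain ys zs where ys: "P j = ys @ k # zs"
        by (meson split_list)
      have "v (hd ((k # ys) @ [k])) - v k \<le> path_cost W own r ((k # ys) @ k # zs) - path_cost W own r (k # zs)"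
        using path ys by (intro feasible_pot_path[OF v]) simp
      then have "path_cost W own r (k # zs) \<le> D' k"
        using cost ys by simp
      moreover have "D k \<le> path_cost W own r (k # zs)"
        using pj(5) ys by blast
      ultimately show False using j(4) by simp
    qed
    moreover have "D' x \<le> path_cost W own r (x # zs)" if "k # P j = ys @ x # zs" for ys x zs
    proof (cases ys)
      case Nil
      then show ?thesis using that cost by simp
    next
      case (Cons y ys')
      then have ys': "P j = ys' @ x # zs" using that by simp
      then have "D x \<le> path_cost W own r (x # zs)" "x \<in> cols"
        using pj(5) set[OF j(1)] by auto
      with le show ?thesis by force
    qed
    ultimately show ?thesis
      using j(5) path cost pj(3) by (auto simp del: path_cost.simps)
  qed
  then show "alt_path cols own (P' k)" "hd (P' k) = k" "distinct (P' k)" "D' k = path_cost W own r (P' k)"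
    "\<forall>ys x zs. P' k = ys @ x # zs \<longrightarrow> D' x \<le> path_cost W own r (x # zs)" by auto
next
  show "\<forall>p. alt_path cols own p \<longrightarrow> length p \<le> Suc (Suc t) \<longrightarrow> D' (hd p) \<le> path_cost W own r p"
  proof (intro allI impI)
    fix p assume p: "alt_path cols own p" "length p \<le> Suc (Suc t)"
    have le: "D' x \<le> D x" if "x \<in> cols" for x
      using rel that by (simp add: relaxed_def)
    show "D' (hd p) \<le> path_cost W own r p"
    proof (cases "\<exists>x y q. p = x # y # q")
      case True
      then obtain x y q where q: "p = x # y # q" by blast
      obtain i where i: "own y = Some i" using p q by (auto simp: alt_path_Cons)
      have yq: "alt_path cols own (y # q)" "x \<in> cols" "y \<in> cols"
        using p(1) q by (auto simp: alt_path_def)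
      have "D' x \<le> D y - W i y + W i x"
        using rel i yq by (auto simp: relaxed_def)
      moreover have "D y \<le> path_cost W own r (y # q)"
        using inv yq p(2) q by (fastforce simp: paths_inv_def)
      ultimately show ?thesis using q i by simp
    next
      case False
      then have "p = [hd p]" using p(1) by (cases p rule: remdups_adj.cases) (auto simp: alt_path_def)
      then have "D (hd p) \<le> path_cost W own r p"
        using inv p unfolding paths_inv_def by (metis Suc_le_mono le0 length_Cons list.size(3))
      moreover have "hd p \<in> cols" using p(1) by (auto simp: alt_path_def)
      ultimately show ?thesis using le by force
    qed
  qed
qed

text \<open>The triangle inequality is the last clause of the invariant for the walk
  \<open>k' # P k\<close>. As \<open>P k\<close> is simple, this walk has at most
  \<open>card cols + 1\<close> columns, possibly with \<open>k'\<close> repeated; hence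
  \<open>card cols\<close> rounds.\<close>

lemma paths_inv_feasible_pot:
  assumes inv: "paths_inv W cols own r (card cols) D P" and fin: "finite cols" and dom: "dom own \<subseteq> cols"
  shows "feasible_pot W cols own D"
  unfolding feasible_pot_def
proof (intro allI impI)
  fix k i k' assume ki: "own k = Some i" and k': "k' \<in> cols"
  have k: "k \<in> cols" using dom ki by auto
  have P: "alt_path cols own (P k)" "hd (P k) = k" "distinct (P k)" "D k = path_cost W own r (P k)"
    using inv k by (auto simp: paths_inv_def)
  obtain q where q: "P k = k # q"
    using P(1,2) by (cases "P k") (auto simp: alt_path_def)
  have path: "alt_path cols own (k' # P k)"
    using P(1) q ki k' by (auto simp: alt_path_def)
  have cost: "path_cost W own r (k' # P k) = D k - W i k + W i k'"
    using P(4) q ki by simp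
  have "length (P k) \<le> card cols"
    using P(1,3) fin by (metis alt_path_def card_mono distinct_card)
  then have short: "D (hd p) \<le> path_cost W own r p" if "alt_path cols own p" "length p \<le> Suc (length (P k))" for p
    using inv that by (auto simp: paths_inv_def)
  show "D k' \<le> D k - W i k + W i k'"
    using short[OF path] cost by simp
qed

lemma paths_inv_le_row:
  assumes "paths_inv W cols own r t D P" "k \<in> cols"
  shows "D k \<le> W r k"
proof -
  have "alt_path cols own [k] \<longrightarrow> length [k] \<le> Suc t \<longrightarrow> D (hd [k]) \<le> path_cost W own r [k]"
    using assms(1) unfolding paths_inv_def by blast
  then show ?thesis using assms(2) by (simp add: alt_path_def)
qed

section \<open>Sizes of rational numbers\<close>

lemma numbers_closed:
  assumes "x \<in> numbers m" "y \<in> numbers m"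
  shows "x + y \<in> numbers m" "x - y \<in> numbers m" "x * y \<in> numbers m" "x / y \<in> numbers m"
  using assms by (cases m; simp)+

lemma of_int_numbers: "of_int k \<in> numbers m"
  by (cases m) simp_all

text \<open>
  Sums and products of rationals of size at most \<open>s\<close> are controlled by the number \<open>k\<close> of
  operands. Separate bounds for numerator and denominator are what makes this linear in \<open>k\<close>.
\<close>

definition fits :: "cost_model \<Rightarrow> nat \<Rightarrow> nat \<Rightarrow> real \<Rightarrow> bool" where
  "fits m s k x \<longleftrightarrow> (m = Bit_Cost \<longrightarrow>
     (\<exists>p q :: int. 0 < q \<and> q \<le> 2 ^ (s * k) \<and> \<bar>p\<bar> \<le> 2 ^ (2 * s * k) \<and> x = of_int p / of_int q))"

lemma fitsE:
  assumes "fits Bit_Cost s k x"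
  obtains p q :: int where "0 < q" "q \<le> 2 ^ (s * k)" "\<bar>p\<bar> \<le> 2 ^ (2 * s * k)" "x = of_int p / of_int q"
  using assms unfolding fits_def by blast

lemma fitsI:
  assumes "0 < q" "q \<le> 2 ^ (s * k)" "\<bar>p\<bar> \<le> 2 ^ (2 * s * k)" "x = of_int p / of_int q"
  shows "fits m s k x"
  using assms unfolding fits_def by blast

lemma floorlog_le_Suc:
  assumes "a \<le> 2 ^ k"
  shows "floorlog 2 a \<le> Suc k"
proof (rule floorlog_leI)
  have "a < 2 ^ Suc k" using assms by (simp add: less_le_trans le_less_trans)
  then show "a < 2 ^ Suc k" by simp
qed simp_all

text \<open>Cancelling the gcd only shrinks numerator and denominator, so sizes may be estimated
  from unreduced fractions. The 2 comes from powers of two, where \<open>floorlog\<close> exceeds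
  the exponent by one.\<close>

lemma bit_size_Fract_le:
  assumes "0 < q" "q \<le> 2 ^ b" "\<bar>p\<bar> \<le> 2 ^ a"
  shows "bit_size (Fract p q) \<le> a + b + 2"
proof -
  define g where "g = gcd p q"
  have "quotient_of (Fract p q) = (p div g, q div g)"
    using assms(1) by (simp add: quotient_of_Fract Rat.normalize_def g_def Let_def)
  then have size: "bit_size (Fract p q) = floorlog 2 (nat \<bar>p div g\<bar>) + floorlog 2 (nat (q div g))"
    by (simp add: bit_size_def)
  have div: "\<bar>x div g\<bar> \<le> \<bar>x\<bar>" if "g dvd x" for x
  proof -
    have "g \<ge> 1" using assms(1) by (simp add: g_def int_one_le_iff_zero_less)
    moreover obtain k where "x = g * k" using \<open>g dvd x\<close> by blast
    ultimately show ?thesis by (simp add: abs_mult mult_le_cancel_right1)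
  qed
  have "nat \<bar>p div g\<bar> \<le> 2 ^ a"
    using div[of p] assms(3) by (simp add: g_def nat_le_iff)
  moreover have "nat (q div g) \<le> 2 ^ b"
    using div[of q] assms(1,2) by (simp add: g_def nat_le_iff)
  ultimately show ?thesis
    using size floorlog_le_Suc[of "nat \<bar>p div g\<bar>" a] floorlog_le_Suc[of "nat (q div g)" b] by linarith
qed

lemma number_size_fits:
  assumes "fits m s k x"
  shows "number_size m x \<le> 3 * s * k + 2"
proof (cases m)
  case Bit_Cost
  obtain p q :: int where pq: "0 < q" "q \<le> 2 ^ (s * k)" "\<bar>p\<bar> \<le> 2 ^ (2 * s * k)" "x = of_int p / of_int q"
    using fitsE[OF assms(1)[unfolded Bit_Cost]] by metis
  have "x = real_of_rat (Fract p q)"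
    using pq(1,4) by (simp add: of_rat_rat)
  then have "inv real_of_rat x = Fract p q"
    by (metis inj_on_def inv_f_f of_rat_eq_iff)
  then show ?thesis
    using bit_size_Fract_le[OF pq(1-3)] Bit_Cost by (simp add: mult.assoc mult.commute mult.left_commute)
qed simp

lemma less_two_power_floorlog: "n < 2 ^ floorlog 2 n"
  using floorlog_bounds[of n 2] by (cases "n = 0") (auto simp: floorlog_def)

lemma fits_of_size:
  assumes "x \<in> numbers m" "number_size m x \<le> s"
  shows "fits m s 1 x"
proof (cases m)
  case m: Bit_Cost
  then obtain r where r: "x = real_of_rat r"
    using assms(1) by (auto elim: Rats_cases)
  obtain p q where pq: "quotient_of r = (p, q)" by fastforce
  have q: "0 < q" using quotient_of_denom_pos[OF pq] .
  have "r = of_int p / of_int q" using quotient_of_div[OF pq] .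
  then have x: "x = of_int p / of_int q" using r by (simp add: of_rat_divide)
  have "inv real_of_rat x = r"
    unfolding r by (metis inj_on_def inv_f_f of_rat_eq_iff)
  then have s: "floorlog 2 (nat \<bar>p\<bar>) \<le> s" "floorlog 2 (nat q) \<le> s"
    using assms(2) m pq by (simp_all add: bit_size_def)
  have "nat q \<le> 2 ^ s" "nat \<bar>p\<bar> \<le> 2 ^ s"
    using less_two_power_floorlog[of "nat q"] less_two_power_floorlog[of "nat \<bar>p\<bar>"] s
    by (meson less_imp_le le_trans one_le_numeral power_increasing)+
  then have "q \<le> 2 ^ s" "\<bar>p\<bar> \<le> 2 ^ s"
    by (simp_all add: nat_le_iff)
  moreover have "(2::int) ^ s \<le> 2 ^ (2 * s)"
    by (intro power_increasing) auto
  ultimately have "q \<le> 2 ^ (s * 1)" "\<bar>p\<bar> \<le> 2 ^ (2 * s * 1)"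
    unfolding mult_1_right by linarith+
  then show ?thesis
    using q x by (intro fitsI)
qed (simp add: fits_def)

lemma fits_mono:
  assumes "fits m s k x" "k \<le> l"
  shows "fits m s l x"
proof (cases m)
  case Bit_Cost
  obtain p q :: int where pq: "0 < q" "q \<le> 2 ^ (s * k)" "\<bar>p\<bar> \<le> 2 ^ (2 * s * k)" "x = of_int p / of_int q"
    by (rule fitsE[OF assms(1)[unfolded Bit_Cost]])
  have "(2::int) ^ (s * k) \<le> 2 ^ (s * l)" "(2::int) ^ (2 * s * k) \<le> 2 ^ (2 * s * l)"
    using assms(2) by (intro power_increasing mult_le_mono le_refl; simp)+
  then show ?thesis
    using fitsI[OF pq(1) order_trans[OF pq(2)] order_trans[OF pq(3)] pq(4)] by blast
qed (simp add: fits_def)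

lemma fits_uminus:
  assumes "fits m s k x"
  shows "fits m s k (- x)"
proof (cases m)
  case Bit_Cost
  obtain p q :: int where pq: "0 < q" "q \<le> 2 ^ (s * k)" "\<bar>p\<bar> \<le> 2 ^ (2 * s * k)" "x = of_int p / of_int q"
    by (rule fitsE[OF assms(1)[unfolded Bit_Cost]])
  show ?thesis
    by (rule fitsI[of q _ _ "- p"]) (use pq in simp_all)
qed (simp add: fits_def)

lemma fits_mult:
  assumes "fits m s k x" "fits m s l y"
  shows "fits m s (k + l) (x * y)"
proof (cases m)
  case Bit_Cost
  obtain p q :: int where p: "0 < q" "q \<le> 2 ^ (s * k)" "\<bar>p\<bar> \<le> 2 ^ (2 * s * k)" "x = of_int p / of_int q"
    by (rule fitsE[OF assms(1)[unfolded Bit_Cost]])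
  obtain p' q' :: int where p': "0 < q'" "q' \<le> 2 ^ (s * l)" "\<bar>p'\<bar> \<le> 2 ^ (2 * s * l)" "y = of_int p' / of_int q'"
    by (rule fitsE[OF assms(2)[unfolded Bit_Cost]])
  have "q * q' \<le> 2 ^ (s * (k + l))"
    unfolding distrib_left power_add using p p' by (intro mult_mono) auto
  moreover have "\<bar>p * p'\<bar> \<le> 2 ^ (2 * s * (k + l))"
    unfolding abs_mult distrib_left power_add using p p' by (intro mult_mono) auto
  moreover have "x * y = of_int (p * p') / of_int (q * q')"
    using p(4) p'(4) by simp
  moreover have "0 < q * q'" using p(1) p'(1) by simp
  ultimately show ?thesis by (intro fitsI)
qed (simp add: fits_def)

lemma fits_add:
  assumes "fits m s k x" "fits m s l y" "0 < s" "0 < k" "0 < l"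
  shows "fits m s (k + l) (x + y)"
proof (cases m)
  case Bit_Cost
  obtain p q :: int where p: "0 < q" "q \<le> 2 ^ (s * k)" "\<bar>p\<bar> \<le> 2 ^ (2 * s * k)" "x = of_int p / of_int q"
    by (rule fitsE[OF assms(1)[unfolded Bit_Cost]])
  obtain p' q' :: int where p': "0 < q'" "q' \<le> 2 ^ (s * l)" "\<bar>p'\<bar> \<le> 2 ^ (2 * s * l)" "y = of_int p' / of_int q'"
    by (rule fitsE[OF assms(2)[unfolded Bit_Cost]])
  have "q * q' \<le> 2 ^ (s * (k + l))"
    unfolding distrib_left power_add using p p' by (intro mult_mono) auto
  moreover have half: "2 * (2 ^ (2 * s * a) * 2 ^ (s * b)) \<le> (2 :: int) ^ (2 * s * (a + b))" if "0 < b" for a b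
  proof -
    have "Suc (2 * s * a + s * b) \<le> 2 * s * (a + b)"
      using that assms(3) by (simp add: algebra_simps Suc_le_eq)
    then have "(2::int) ^ Suc (2 * s * a + s * b) \<le> 2 ^ (2 * s * (a + b))"
      by (rule power_increasing) simp
    then show ?thesis by (simp only: power_Suc power_add)
  qed
  have "\<bar>p * q' + p' * q\<bar> \<le> \<bar>p\<bar> * q' + \<bar>p'\<bar> * q"
    using p(1) p'(1) by (metis abs_mult abs_of_pos abs_triangle_ineq)
  moreover have "\<bar>p\<bar> * q' \<le> 2 ^ (2 * s * k) * 2 ^ (s * l)" "\<bar>p'\<bar> * q \<le> 2 ^ (2 * s * l) * 2 ^ (s * k)"
    using p p' by (auto intro!: mult_mono)
  ultimately have "\<bar>p * q' + p' * q\<bar> \<le> 2 ^ (2 * s * (k + l))"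
    using half[OF assms(5), of k] half[OF assms(4), of l] unfolding add.commute[of l k] by linarith
  moreover have "x + y = of_int (p * q' + p' * q) / of_int (q * q')"
    using p(1,4) p'(1,4) by (simp add: add_frac_eq)
  moreover have "0 < q * q'" using p(1) p'(1) by simp
  ultimately show ?thesis
    using \<open>q * q' \<le> _\<close> by (intro fitsI)
qed (simp add: fits_def)

lemma fits_diff:
  "fits m s k x \<Longrightarrow> fits m s l y \<Longrightarrow> 0 < s \<Longrightarrow> 0 < k \<Longrightarrow> 0 < l \<Longrightarrow> fits m s (k + l) (x - y)"
  using fits_add[of m s k x l "- y"] fits_uminus by simp

lemma number_size_small [simp]: "number_size m 1 \<le> 2" "number_size m 0 \<le> 2" "number_size m (-1) \<le> 2"
proof -
  have "inv real_of_rat (of_int k) = of_int k" for k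
    by (metis inj_on_def inv_f_f of_rat_eq_iff of_rat_of_int_eq)
  note this[of 1, simplified] this[of 0, simplified] this[of "-1", simplified]
  then show "number_size m 1 \<le> 2" "number_size m 0 \<le> 2" "number_size m (-1) \<le> 2"
    by (cases m; simp add: bit_size_def floorlog_def)+
qed

section \<open>Computations stay within the numbers of the cost model\<close>

lemma binary_numbers:
  assumes "val_numbers v \<subseteq> numbers m"
    and "\<And>x y. x \<in> numbers m \<Longrightarrow> y \<in> numbers m \<Longrightarrow> val_numbers (f x y) \<subseteq> numbers m"
  shows "val_numbers (binary f v) \<subseteq> numbers m"
  using assms by (induction f v rule: binary.induct) auto

text \<open>In the bit model arithmetic preserves rationality, division by zero included, and
  primitives return \<open>VNil\<close>. Thus a computed compensation is a legal argument for the
  program that evaluates acceptance probabilities.\<close>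

lemma runs_numbers:
  assumes "runs m p v w t" "val_numbers v \<subseteq> numbers m"
  shows "val_numbers w \<subseteq> numbers m"
  using assms
proof (induction rule: runs.induct)
  case (Basic b v)
  have bool: "val_numbers (vbool c) \<subseteq> numbers m" for c
    using of_int_numbers[of 1 m] by (simp add: vbool_def)
  show ?case
  proof (cases b)
    case (Prim k)
    then show ?thesis by (cases m; cases v) auto
  next
    case Less
    then show ?thesis using Basic bool binary_numbers[OF Basic] by simp
  qed (use Basic bool binary_numbers[OF Basic] in
      \<open>auto simp: of_int_numbers numbers_closed split: val.split simp del: numbers.simps\<close>)
qed (auto simp del: numbers.simps)

section \<open>Symbolic execution\<close>

definition bounded :: "cost_model \<Rightarrow> nat \<Rightarrow> val \<Rightarrow> bool" where
  "bounded m B v \<longleftrightarrow> 2 \<le> B \<and> (\<forall>x\<in>val_numbers v. number_size m x \<le> B)"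

text \<open>
  Only arithmetic creates new numbers, so that all other programs preserve \<open>bounded\<close> and the bound
  need not be mentioned in their specifications. The condition \<open>2 \<le> B\<close> accounts for the literals.
\<close>

definition steps :: "cost_model \<Rightarrow> nat \<Rightarrow> prog \<Rightarrow> val \<Rightarrow> val \<Rightarrow> nat \<Rightarrow> bool" where
  "steps m B p v w n \<longleftrightarrow>
     (bounded m B v \<longrightarrow> bounded m B w \<and> (\<exists>t. runs m p v w t \<and> t \<le> n * (4 * B + 1)))"

lemma bounded_simps [simp]:
  "bounded m B (VPair v w) \<longleftrightarrow> bounded m B v \<and> bounded m B w"
  "bounded m B VNil \<longleftrightarrow> 2 \<le> B"
  "bounded m B (VNum x) \<longleftrightarrow> 2 \<le> B \<and> number_size m x \<le> B"
  by (auto simp: bounded_def)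

lemma visible_size_le: "bounded m B v \<Longrightarrow> visible_size m v \<le> 2 * B"
  by (induction m v rule: visible_size.induct) auto

lemma steps_weaken:
  "steps m B p v w n \<Longrightarrow> n \<le> n' \<Longrightarrow> steps m B p v w n'"
  unfolding steps_def by (meson le_trans mult_le_mono1)

lemma steps_cong: "steps m B p v w n \<Longrightarrow> w = w' \<Longrightarrow> n \<le> n' \<Longrightarrow> steps m B p v w' n'"
  using steps_weaken by blast

text \<open>The argument and the result each show at most two numbers of size at most
  \<open>B\<close>; this is the origin of the unit \<open>4 * B + 1\<close> in which
  \<open>steps\<close> counts.\<close>

lemma steps_Basic:
  assumes "bounded m B v \<Longrightarrow> bounded m B (apply_basic m b v)"
  shows "steps m B (Basic b) v (apply_basic m b v) 1"
  unfolding steps_def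
proof
  assume v: "bounded m B v"
  have "basic_time m b v \<le> 4 * B + 1"
    using visible_size_le[OF v] visible_size_le[OF assms[OF v]] by (simp add: basic_time_def)
  then show "bounded m B (apply_basic m b v) \<and>
      (\<exists>t. runs m (Basic b) v (apply_basic m b v) t \<and> t \<le> 1 * (4 * B + 1))"
    using assms[OF v] runs.Basic[of m b v] by auto
qed

lemma steps_Copy: "steps m B (Basic Copy) v v 1"
  using steps_Basic[of m B v Copy] by simp

lemma steps_Empty: "steps m B (Basic Empty) v VNil 1"
  using steps_Basic[of m B v Empty] by (simp add: bounded_def)

lemma steps_Head: "steps m B (Basic Head) (VPair v w) v 1"
  using steps_Basic[of m B "VPair v w" Head] by simp

lemma steps_Tail: "steps m B (Basic Tail) (VPair v w) w 1"
  using steps_Basic[of m B "VPair v w" Tail] by simp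

lemma number_size_small_le: "2 \<le> B \<Longrightarrow> number_size m 1 \<le> B" "2 \<le> B \<Longrightarrow> number_size m 0 \<le> B"
  "2 \<le> B \<Longrightarrow> number_size m (-1) \<le> B"
  by (meson number_size_small order_trans)+

lemma steps_Lit:
  "steps m B (Basic (Lit 0)) v (VNum 0) 1" "steps m B (Basic (Lit 1)) v (VNum 1) 1"
  "steps m B (Basic (Lit (-1))) v (VNum (-1)) 1"
  using steps_Basic[of m B v "Lit 0"] steps_Basic[of m B v "Lit 1"] steps_Basic[of m B v "Lit (-1)"]
  by (simp_all add: bounded_def number_size_small_le)

lemma steps_Less: "steps m B (Basic Less) (VPair (VNum x) (VNum y)) (vbool (x < y)) 1"
  using steps_Basic[of m B "VPair (VNum x) (VNum y)" Less]
  by (simp add: vbool_def number_size_small_le)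

lemma steps_arith:
  "number_size m (x + y) \<le> B \<Longrightarrow> steps m B (Basic Plus) (VPair (VNum x) (VNum y)) (VNum (x + y)) 1"
  "number_size m (x - y) \<le> B \<Longrightarrow> steps m B (Basic Minus) (VPair (VNum x) (VNum y)) (VNum (x - y)) 1"
  "number_size m (x * y) \<le> B \<Longrightarrow> steps m B (Basic Times) (VPair (VNum x) (VNum y)) (VNum (x * y)) 1"
  using steps_Basic[of m B "VPair (VNum x) (VNum y)" Plus] steps_Basic[of m B "VPair (VNum x) (VNum y)" Minus]
    steps_Basic[of m B "VPair (VNum x) (VNum y)" Times] by auto

lemma mult_Suc_le: "s \<le> a * c \<Longrightarrow> t \<le> b * c \<Longrightarrow> 1 \<le> c \<Longrightarrow> 1 + s + t \<le> (1 + a + b) * (c :: nat)"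
  by (simp add: distrib_right)

lemma steps_Seq:
  assumes "steps m B p u v s" "steps m B q v w t"
  shows "steps m B (Seq p q) u w (1 + s + t)"
  unfolding steps_def
proof
  assume "bounded m B u"
  then obtain s' t' where "runs m p u v s'" "s' \<le> s * (4 * B + 1)" "runs m q v w t'" "t' \<le> t * (4 * B + 1)"
    and w: "bounded m B w"
    using assms by (auto simp: steps_def)
  then have "runs m (Seq p q) u w (1 + s' + t')" "1 + s' + t' \<le> (1 + s + t) * (4 * B + 1)"
    using runs.Seq by (blast, intro mult_Suc_le) auto
  with w show "bounded m B w \<and> (\<exists>t'. runs m (Seq p q) u w t' \<and> t' \<le> (1 + s + t) * (4 * B + 1))"
    by blast
qed

lemma steps_Fork:
  assumes "steps m B p u v s" "steps m B q u w t"
  shows "steps m B (Fork p q) u (VPair v w) (1 + s + t)"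
  unfolding steps_def
proof
  assume "bounded m B u"
  then obtain s' t' where "runs m p u v s'" "s' \<le> s * (4 * B + 1)" "runs m q u w t'" "t' \<le> t * (4 * B + 1)"
    and w: "bounded m B (VPair v w)"
    using assms by (auto simp: steps_def)
  then have "runs m (Fork p q) u (VPair v w) (1 + s' + t')" "1 + s' + t' \<le> (1 + s + t) * (4 * B + 1)"
    using runs.Fork by (blast, intro mult_Suc_le) auto
  with w show "bounded m B (VPair v w) \<and> (\<exists>t'. runs m (Fork p q) u (VPair v w) t' \<and> t' \<le> (1 + s + t) * (4 * B + 1))"
    by blast
qed

lemma steps_If_True:
  assumes "steps m B b u v s" "v \<noteq> VNil" "steps m B p u w t"
  shows "steps m B (If b p q) u w (1 + s + t)"
  unfolding steps_def
proof
  assume "bounded m B u"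
  then obtain s' t' where "runs m b u v s'" "s' \<le> s * (4 * B + 1)" "runs m p u w t'" "t' \<le> t * (4 * B + 1)"
    and w: "bounded m B w"
    using assms by (auto simp: steps_def)
  then have "runs m (If b p q) u w (1 + s' + t')" "1 + s' + t' \<le> (1 + s + t) * (4 * B + 1)"
    using runs.If_True assms(2) by (blast, intro mult_Suc_le) auto
  with w show "bounded m B w \<and> (\<exists>t'. runs m (If b p q) u w t' \<and> t' \<le> (1 + s + t) * (4 * B + 1))"
    by blast
qed

lemma steps_If_False:
  assumes "steps m B b u VNil s" "steps m B q u w t"
  shows "steps m B (If b p q) u w (1 + s + t)"
  unfolding steps_def
proof
  assume "bounded m B u"
  then obtain s' t' where "runs m b u VNil s'" "s' \<le> s * (4 * B + 1)" "runs m q u w t'" "t' \<le> t * (4 * B + 1)"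
    and w: "bounded m B w"
    using assms by (auto simp: steps_def)
  then have "runs m (If b p q) u w (1 + s' + t')" "1 + s' + t' \<le> (1 + s + t) * (4 * B + 1)"
    using runs.If_False by (blast, intro mult_Suc_le) auto
  with w show "bounded m B w \<and> (\<exists>t'. runs m (If b p q) u w t' \<and> t' \<le> (1 + s + t) * (4 * B + 1))"
    by blast
qed

text \<open>The bound adds up both branches, so that symbolic execution can pass a test without a
  case distinction and leave an \<open>if\<close> in the result.\<close>

lemma steps_If_bool:
  assumes "steps m B b u (vbool c) s" "c \<Longrightarrow> steps m B p u w t" "\<not> c \<Longrightarrow> steps m B q u w' t'"
  shows "steps m B (If b p q) u (if c then w else w') (1 + s + (t + t'))"
proof (cases c)
  case True
  have "steps m B (If b p q) u w (1 + s + t)"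
    by (rule steps_If_True) (use assms True in \<open>auto simp: vbool_def\<close>)
  then show ?thesis using True by (auto elim: steps_weaken)
next
  case False
  have "steps m B (If b p q) u w' (1 + s + t')"
    by (rule steps_If_False) (use assms False in \<open>auto simp: vbool_def\<close>)
  then show ?thesis using False by (auto elim: steps_weaken)
qed

lemma steps_While_True:
  assumes "steps m B b u v s" "v \<noteq> VNil" "steps m B p u u' t" "steps m B (While b p) u' w r"
  shows "steps m B (While b p) u w (1 + s + t + r)"
  unfolding steps_def
proof
  assume "bounded m B u"
  then obtain s' t' r' where *: "runs m b u v s'" "s' \<le> s * (4 * B + 1)" "runs m p u u' t'"
      "t' \<le> t * (4 * B + 1)" "runs m (While b p) u' w r'" "r' \<le> r * (4 * B + 1)"
    and w: "bounded m B w"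
    using assms by (auto simp: steps_def)
  then have "runs m (While b p) u w (1 + s' + t' + r')"
    using runs.While_True assms(2) by blast
  moreover have "1 + s' + t' + r' \<le> (1 + s + t + r) * (4 * B + 1)"
    using *(2,4,6) by (simp add: distrib_right)
  ultimately show "bounded m B w \<and> (\<exists>t'. runs m (While b p) u w t' \<and> t' \<le> (1 + s + t + r) * (4 * B + 1))"
    using w by blast
qed

lemma steps_While_False:
  assumes "steps m B b u VNil s"
  shows "steps m B (While b p) u u (1 + s)"
  unfolding steps_def
proof
  assume u: "bounded m B u"
  then obtain s' where "runs m b u VNil s'" "s' \<le> s * (4 * B + 1)"
    using assms by (auto simp: steps_def)
  then have "runs m (While b p) u u (1 + s')" "1 + s' \<le> (1 + s) * (4 * B + 1)"
    using runs.While_False by (auto simp: distrib_right)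
  with u show "bounded m B u \<and> (\<exists>t'. runs m (While b p) u u t' \<and> t' \<le> (1 + s) * (4 * B + 1))"
    by blast
qed

text \<open>The entry point for the two given programs, about which only total time and output are
  known. Counting each time unit as a whole operation is wasteful but keeps the bound
  polynomial.\<close>

lemma steps_runs:
  assumes "runs m p v w t" "t \<le> n" "2 \<le> B \<Longrightarrow> bounded m B w"
  shows "steps m B p v w n"
proof -
  have "n * 1 \<le> n * (4 * B + 1)" by (intro mult_le_mono) auto
  then have "t \<le> n * (4 * B + 1)" using assms(2) by linarith
  then show ?thesis using assms by (auto simp: steps_def bounded_def)
qed

lemmas steps_rules = steps_Seq steps_Fork steps_Copy steps_Empty steps_Head steps_Tail steps_Lit steps_Less

text \<open>
  Programs are run on an environment \<open>VPair v\<^sub>0 (VPair v\<^sub>1 \<dots>)\<close>; \<open>Let_in p q\<close> and the bodies of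
  \<open>Fold\<close> and \<open>Map\<close> extend it on the left, in the latter two by an element of the list and by
  the accumulator.
\<close>

abbreviation V0 :: prog where "V0 \<equiv> Basic Head"
abbreviation V1 :: prog where "V1 \<equiv> Seq (Basic Tail) V0"
abbreviation V2 :: prog where "V2 \<equiv> Seq (Basic Tail) V1"
abbreviation V3 :: prog where "V3 \<equiv> Seq (Basic Tail) V2"
abbreviation V4 :: prog where "V4 \<equiv> Seq (Basic Tail) V3"
abbreviation V5 :: prog where "V5 \<equiv> Seq (Basic Tail) V4"
abbreviation V6 :: prog where "V6 \<equiv> Seq (Basic Tail) V5"

abbreviation hd_of :: "prog \<Rightarrow> prog" where "hd_of p \<equiv> Seq p (Basic Head)"
abbreviation tl_of :: "prog \<Rightarrow> prog" where "tl_of p \<equiv> Seq p (Basic Tail)"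
abbreviation op2 :: "basic \<Rightarrow> prog \<Rightarrow> prog \<Rightarrow> prog" where "op2 b p q \<equiv> Seq (Fork p q) (Basic b)"
abbreviation Let_in :: "prog \<Rightarrow> prog \<Rightarrow> prog" where "Let_in p q \<equiv> Seq (Fork p (Basic Copy)) q"

text \<open>The loop state consists of the remaining list, the accumulator and the environment. Its
  head is \<open>VNil\<close> exactly when the list is exhausted, so \<open>Basic Head\<close>
  serves as the loop test.\<close>

definition Fold :: "prog \<Rightarrow> prog \<Rightarrow> prog \<Rightarrow> prog" where
  "Fold xs a body = Seq (Fork xs (Fork a (Basic Copy)))
     (Seq (While (Basic Head) (Fork (tl_of V0) (Fork (Seq (Fork (hd_of V0) (Basic Tail)) body) (Seq (Basic Tail) (Basic Tail)))))
       V1)"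

definition Rev :: "prog \<Rightarrow> prog" where
  "Rev p = Fold p (Basic Empty) (Fork V0 V1)"

definition Map :: "prog \<Rightarrow> prog \<Rightarrow> prog" where
  "Map xs body = Rev (Fold xs (Basic Empty) (Fork body V1))"

definition Zip :: "prog \<Rightarrow> prog \<Rightarrow> prog" where
  "Zip p q = Rev (tl_of (Fold p (Fork q (Basic Empty))
     (Fork (tl_of (hd_of V1)) (Fork (Fork V0 (hd_of (hd_of V1))) (tl_of V1)))))"

definition Eq :: "prog \<Rightarrow> prog \<Rightarrow> prog" where
  "Eq p q = If (op2 Less p q) (Basic Empty) (If (op2 Less q p) (Basic Empty) (Basic (Lit 1)))"

section \<open>Running times of the list combinators\<close>

lemma steps_While_Fold:
  assumes "I 0 w"
    and "\<And>k w. k < length vs \<Longrightarrow> I k w \<Longrightarrow>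
      \<exists>w'. steps m B body (VPair (vs ! k) (VPair w u)) w' n \<and> I (Suc k) w'"
  shows "\<exists>w'. I (length vs) w' \<and>
    steps m B (While (Basic Head) (Fork (tl_of V0) (Fork (Seq (Fork (hd_of V0) (Basic Tail)) body) (Seq (Basic Tail) (Basic Tail)))))
      (VPair (vlist vs) (VPair w u)) (VPair VNil (VPair w' u)) (length vs * (n + 20) + 2)"
  using assms
proof (induction vs arbitrary: I w)
  case Nil
  have "steps m B (Basic Head) (VPair VNil (VPair w u)) VNil 1"
    by (rule steps_Head)
  from steps_While_False[OF this] Nil show ?case by (auto simp: numeral_2_eq_2)
next
  case (Cons v vs)
  obtain w1 where w1: "steps m B body (VPair v (VPair w u)) w1 n" "I (Suc 0) w1"
    using Cons.prems(2)[of 0 w] Cons.prems(1) by auto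
  obtain w' where w': "I (Suc (length vs)) w'"
    "steps m B (While (Basic Head) (Fork (tl_of V0) (Fork (Seq (Fork (hd_of V0) (Basic Tail)) body) (Seq (Basic Tail) (Basic Tail)))))
      (VPair (vlist vs) (VPair w1 u)) (VPair VNil (VPair w' u)) (length vs * (n + 20) + 2)"
  proof -
    have "\<exists>w''. steps m B body (VPair (vs ! k) (VPair w' u)) w'' n \<and> I (Suc (Suc k)) w''"
      if "k < length vs" "I (Suc k) w'" for k w'
      using Cons.prems(2)[of "Suc k" w'] that by simp
    then show ?thesis using Cons.IH[of "\<lambda>k. I (Suc k)" w1] w1(2) that by blast
  qed
  have "steps m B (While (Basic Head) (Fork (tl_of V0) (Fork (Seq (Fork (hd_of V0) (Basic Tail)) body) (Seq (Basic Tail) (Basic Tail)))))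
      (VPair (vlist (v # vs)) (VPair w u)) (VPair VNil (VPair w' u)) (length (v # vs) * (n + 20) + 2)"
    unfolding vlist.simps
    by (rule steps_weaken, rule steps_While_True, rule steps_rules, simp, (rule steps_rules w1(1))+, rule w'(2)) simp
  with w'(1) show ?case by auto
qed

text \<open>The form with an invariant, for loops whose accumulator is not given by a formula but
  known only to encode some table or matching with the right properties.\<close>

lemma steps_Fold_ex:
  assumes "steps m B xs u (vlist vs) s" "steps m B a u w0 t" "I 0 w0"
    and "\<And>k w. k < length vs \<Longrightarrow> I k w \<Longrightarrow>
      \<exists>w'. steps m B body (VPair (vs ! k) (VPair w u)) w' n \<and> I (Suc k) w'"
  shows "\<exists>w. steps m B (Fold xs a body) u w (s + t + length vs * (n + 20) + 20) \<and> I (length vs) w"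
proof -
  obtain w where w: "I (length vs) w"
    "steps m B (While (Basic Head) (Fork (tl_of V0) (Fork (Seq (Fork (hd_of V0) (Basic Tail)) body) (Seq (Basic Tail) (Basic Tail)))))
      (VPair (vlist vs) (VPair w0 u)) (VPair VNil (VPair w u)) (length vs * (n + 20) + 2)"
    using steps_While_Fold[of I w0 vs m B body u n] assms(3,4) by blast
  have "steps m B (Fold xs a body) u w (s + t + length vs * (n + 20) + 20)"
    unfolding Fold_def
    by (rule steps_weaken, (rule steps_Seq steps_Fork assms(1,2) steps_Copy w(2) steps_Head steps_Tail)+) simp
  with w(1) show ?thesis by blast
qed

lemma steps_Fold:
  assumes "steps m B xs u (vlist vs) s" "steps m B a u (A 0) t"
    and "\<And>k. k < length vs \<Longrightarrow> steps m B body (VPair (vs ! k) (VPair (A k) u)) (A (Suc k)) n"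
  shows "steps m B (Fold xs a body) u (A (length vs)) (s + t + length vs * (n + 20) + 20)"
  using steps_Fold_ex[OF assms(1,2), of "\<lambda>k w. w = A k" body n] assms(3) by auto

lemma steps_Rev:
  assumes "steps m B p u (vlist vs) s"
  shows "steps m B (Rev p) u (vlist (rev vs)) (s + length vs * 30 + 30)"
proof -
  have "steps m B (Rev p) u (vlist (rev (take (length vs) vs))) (s + 1 + length vs * (9 + 20) + 20)"
    unfolding Rev_def
  proof (rule steps_Fold[where A = "\<lambda>k. vlist (rev (take k vs))"])
    fix k assume k: "k < length vs"
    show "steps m B (Fork V0 V1) (VPair (vs ! k) (VPair (vlist (rev (take k vs))) u)) (vlist (rev (take (Suc k) vs))) 9"
      by (rule steps_cong, (rule steps_rules)+) (simp_all add: k take_Suc_conv_app_nth)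
  qed (use assms in \<open>simp_all add: steps_Empty[simplified]\<close>)
  then show ?thesis by (auto elim: steps_weaken)
qed

lemma steps_Map:
  assumes "steps m B xs u (vlist (map e cs)) s"
    and "\<And>c a. c \<in> set cs \<Longrightarrow> steps m B body (VPair (e c) (VPair a u)) (f c) n"
  shows "steps m B (Map xs body) u (vlist (map f cs)) (s + length cs * (n + 70) + 70)"
proof -
  let ?A = "\<lambda>k. vlist (rev (map f (take k cs)))"
  have "steps m B (Fold xs (Basic Empty) (Fork body V1)) u (?A (length (map e cs)))
      (s + 1 + length (map e cs) * ((n + 10) + 20) + 20)"
  proof (rule steps_Fold[where A = ?A])
    fix k assume k: "k < length (map e cs)"
    then have f: "steps m B body (VPair (map e cs ! k) (VPair a u)) (f (cs ! k)) n" for a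
      using assms(2)[of "cs ! k" a] by simp
    show "steps m B (Fork body V1) (VPair (map e cs ! k) (VPair (?A k) u)) (?A (Suc k)) (n + 10)"
      by (rule steps_cong, (rule f steps_rules)+) (use k in \<open>simp_all add: take_Suc_conv_app_nth\<close>)
  qed (use assms(1) in \<open>simp_all add: steps_Empty[simplified]\<close>)
  from steps_Rev[OF this[simplified]] show ?thesis
    unfolding Map_def by (rule steps_cong) (simp_all add: rev_map[symmetric] algebra_simps)
qed

lemma steps_Zip:
  assumes "steps m B p u (vlist (map e cs)) s" "steps m B q u (vlist (map f cs)) t"
  shows "steps m B (Zip p q) u (vlist (map (\<lambda>c. VPair (e c) (f c)) cs)) (s + t + length cs * 100 + 100)"
proof -
  let ?A = "\<lambda>k. VPair (vlist (map f (drop k cs))) (vlist (rev (map (\<lambda>c. VPair (e c) (f c)) (take k cs))))"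
  have fold: "steps m B (Fold p (Fork q (Basic Empty)) (Fork (tl_of (hd_of V1)) (Fork (Fork V0 (hd_of (hd_of V1))) (tl_of V1))))
      u (?A (length (map e cs))) (s + (t + 2) + length (map e cs) * (40 + 20) + 20)"
  proof (rule steps_Fold[where A = ?A])
    fix k assume k: "k < length (map e cs)"
    then have d: "drop k cs = cs ! k # drop (Suc k) cs"
      by (simp add: Cons_nth_drop_Suc)
    show "steps m B (Fork (tl_of (hd_of V1)) (Fork (Fork V0 (hd_of (hd_of V1))) (tl_of V1)))
      (VPair (map e cs ! k) (VPair (?A k) u)) (?A (Suc k)) 40"
      unfolding d list.map vlist.simps
      by (rule steps_cong, (rule steps_rules)+) (use k in \<open>simp_all add: take_Suc_conv_app_nth\<close>)
  next
    show "steps m B (Fork q (Basic Empty)) u (?A 0) (t + 2)"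
      by (rule steps_cong, (rule steps_rules assms(2))+) simp_all
  qed (rule assms(1))
  have "steps m B (tl_of (Fold p (Fork q (Basic Empty)) (Fork (tl_of (hd_of V1)) (Fork (Fork V0 (hd_of (hd_of V1))) (tl_of V1)))))
      u (vlist (rev (map (\<lambda>c. VPair (e c) (f c)) cs))) (s + t + length cs * 60 + 30)"
    by (intro steps_cong[OF steps_Seq[OF fold[simplified] steps_Tail]]) simp_all
  from steps_Rev[OF this] show ?thesis
    unfolding Zip_def by (rule steps_cong) (simp_all add: rev_map[symmetric] algebra_simps)
qed

lemma steps_Eq:
  assumes "steps m B p u (VNum x) s" "steps m B q u (VNum y) t"
  shows "steps m B (Eq p q) u (vbool (x = y)) (2 * (s + t) + 20)"
  unfolding Eq_def
  by (rule steps_cong, (rule steps_If_bool steps_rules assms)+) (auto simp: vbool_def)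

section \<open>Inserting a row\<close>

text \<open>
  The environment of \<open>Insert\<close> starts with the row of the new task and the matching.
  \<open>Shortest_Paths\<close> and \<open>Best\<close> each put their result in front of it. \<open>Source\<close> relaxes all
  columns from one column \<open>j\<close>, whose entries in the matching and in the old path table are in
  \<open>V0\<close>; the new path table is the accumulator \<open>V1\<close>. It calls \<open>Relax\<close> with the reduced
  distance of \<open>j\<close> in front. All tables list the columns in the same order (that of \<open>cs\<close>
  below), so that they can be zipped instead of being searched.
\<close>

definition Relax :: prog where
  "Relax = Map (Zip V2 (tl_of (tl_of (tl_of (hd_of V1)))))
     (Let_in (op2 Plus V2 (hd_of (tl_of V0)))
        (If (op2 Less V0 (hd_of (hd_of V1)))
           (Fork V0 (Fork
              (Fork (hd_of (tl_of (tl_of V1)))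
                 (Fork (hd_of (tl_of V1)) (Fork (tl_of (tl_of (tl_of V1))) (tl_of (tl_of (tl_of (hd_of V4)))))))
              (tl_of (tl_of V4))))
           (hd_of V1)))"

definition Source :: prog where
  "Source = If (tl_of (hd_of V0))
     (Let_in (op2 Minus (hd_of (tl_of V0)) (hd_of (tl_of (hd_of V0)))) Relax) V1"

definition Shortest_Paths :: prog where
  "Shortest_Paths = Fold V0
     (Map V0 (Fork (hd_of V0) (Fork (Fork (hd_of (tl_of V0)) (Fork (hd_of V0) (Fork (tl_of (tl_of V0)) V2))) (Basic Empty))))
     (Fold (Zip V3 V1) V1 Source)"

definition Best :: prog where
  "Best = Fold (Zip V2 V0) (Basic Empty)
     (If (tl_of (hd_of V0)) V1
        (If V1 (If (op2 Less (hd_of (tl_of V0)) (hd_of V1)) (tl_of V0) V1) (tl_of V0)))"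

definition Update :: prog where
  "Update = Map V3 (Fold (tl_of V2) V0 (If (Eq (hd_of V0) (hd_of V2)) V0 V1))"

definition Insert :: prog where
  "Insert = Let_in Shortest_Paths (Let_in Best Update)"

locale encoding =
  fixes W :: "nat \<Rightarrow> int \<Rightarrow> real" and out :: "nat \<Rightarrow> int \<Rightarrow> val" and cs :: "int list"
begin

definition row_val :: "nat \<Rightarrow> val" where
  "row_val i = vlist (map (\<lambda>k. VPair (VNum (W i k)) (VPair (VNum (of_int k)) (out i k))) cs)"

text \<open>An entry carries the whole row of the owner and its finished output item, so that
  relaxation and output need no lookup. Sharing of subtrees makes this cheap.\<close>

definition owner_val :: "nat option \<Rightarrow> int \<Rightarrow> val" where
  "owner_val oi k = (case oi of None \<Rightarrow> VNil | Some i \<Rightarrow> VPair (VNum (W i k)) (VPair (out i k) (row_val i)))"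

definition matching_val :: "(int \<rightharpoonup> nat) \<Rightarrow> val" where
  "matching_val own = vlist (map (\<lambda>k. VPair (VNum (of_int k)) (owner_val (own k) k)) cs)"

text \<open>A path is stored as the changes it causes, in the format of matching entries: augmenting
  then merely overwrites entries.\<close>

definition moves_val :: "(int \<rightharpoonup> nat) \<Rightarrow> nat \<Rightarrow> int list \<Rightarrow> val" where
  "moves_val own r p = vlist (map (\<lambda>(k, i). VPair (VNum (of_int k)) (owner_val (Some i) k)) (moves own r p))"

definition paths_val :: "(int \<rightharpoonup> nat) \<Rightarrow> nat \<Rightarrow> (int \<Rightarrow> real) \<Rightarrow> (int \<Rightarrow> int list) \<Rightarrow> val" where
  "paths_val own r D P = vlist (map (\<lambda>k. VPair (VNum (D k)) (moves_val own r (P k))) cs)"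

end

text \<open>A weight has 5 operands: 2 for P C, and 2 + 1 for (1 - P) c'. The largest number is a
  relaxed distance with \<open>10 * (N + 1)\<close> operands, for which
  \<open>number_size_fits\<close> yields the bound required of \<open>B\<close>.\<close>

locale bounded_encoding = encoding W out cs
  for W :: "nat \<Rightarrow> int \<Rightarrow> real" and out :: "nat \<Rightarrow> int \<Rightarrow> val" and cs :: "int list" +
  fixes m :: cost_model and B s :: nat and I :: "nat set"
  assumes distinct_cs: "distinct cs" and s_pos: "0 < s"
    and W_fits: "\<And>i k. i \<in> I \<Longrightarrow> k \<in> set cs \<Longrightarrow> fits m s 5 (W i k)"
    and B: "30 * s * (length cs + 1) + 2 \<le> B"
begin

abbreviation "N \<equiv> length cs"

text \<open>Each further column subtracts one weight and adds another, which makes 10 operands per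
  column.\<close>

lemma path_cost_fits:
  assumes "r \<in> I" "ran own \<subseteq> I" "alt_path (set cs) own p"
  shows "fits m s (10 * length p) (path_cost W own r p)"
  using assms(3)
proof (induction p rule: induct_list012)
  case (2 x)
  then show ?case
    using W_fits[OF assms(1), of x] by (auto simp: alt_path_def elim: fits_mono)
next
  case (3 x y p)
  then obtain i where i: "own y = Some i" "i \<in> I"
    using assms(2) by (auto simp: alt_path_Cons ran_def)
  have cols: "x \<in> set cs" "y \<in> set cs"
    using 3 by (auto simp: alt_path_def)
  have "fits m s (10 * length (y # p)) (path_cost W own r (y # p))"
    using 3 by (simp add: alt_path_Cons)
  then have "fits m s (10 * length (y # p) + 5 + 5) (path_cost W own r (y # p) - W i y + W i x)"
    using W_fits[OF i(2)] cols s_pos by (intro fits_add fits_diff) auto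
  then show ?case using i by (simp add: numeral_eq_Suc)
qed (simp add: alt_path_def)

lemma fits_bounded:
  assumes "fits m s k x" "k \<le> 10 * (N + 1)"
  shows "number_size m x \<le> B"
proof -
  have "3 * s * k \<le> 3 * s * (10 * (N + 1))"
    using assms(2) by (rule mult_le_mono2)
  also have "\<dots> = 30 * s * (N + 1)" by (simp add: algebra_simps)
  finally show ?thesis
    using number_size_fits[OF assms(1)] B by linarith
qed

lemma steps_Relax:
  assumes "own j = Some i" "i \<in> I" "alt_path (set cs) own (P j)" "hd (P j) = j"
    and base: "b = D j - W i j" "fits m s (10 * N + 5) b"
  shows "steps m B Relax
    (VPair (VNum b)
      (VPair (VPair (VPair (VNum (of_int j)) (owner_val (own j) j)) (VPair (VNum (D j)) (moves_val own r (P j))))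
        (VPair (paths_val own r D' P') u)))
    (paths_val own r
       (\<lambda>k. if D j - W i j + W i k < D' k then D j - W i j + W i k else D' k)
       (\<lambda>k. if D j - W i j + W i k < D' k then k # P j else P' k))
    (300 * N + 300)"
proof -
  obtain q where q: "P j = j # q"
    using assms(3,4) by (cases "P j") (auto simp: alt_path_def)
  have ow: "owner_val (own j) j = VPair (VNum (W i j)) (VPair (out i j) (row_val i))"
    by (simp add: owner_val_def assms(1))
  have moves: "moves_val own r (k # P j) =
      VPair (VPair (VNum (of_int k)) (VPair (VNum (W i k)) (VPair (out i k) (row_val i)))) (moves_val own r (P j))" for k
    by (simp add: moves_val_def q assms(1) owner_val_def)
  have size: "number_size m (b + W i k) \<le> B" if "k \<in> set cs" for k
    using fits_add[OF base(2) W_fits[OF assms(2) that] s_pos] by (intro fits_bounded[of "10 * N + 5 + 5"]) auto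
  show ?thesis
    unfolding Relax_def ow
    apply (rule steps_cong, rule steps_Map[where n = 120], rule steps_Zip)
    apply ((rule steps_rules)+)
    apply (subst paths_val_def, rule steps_Head)
    apply ((rule steps_rules)+)
    apply (subst row_val_def, rule steps_rules)
    apply (rule steps_weaken, (rule steps_If_bool steps_rules steps_arith size | assumption)+)
    apply (auto simp: paths_val_def moves base(1) intro!: arg_cong[where f = vlist])
    done
qed

lemma steps_Source:
  assumes "r \<in> I" "ran own \<subseteq> I" "j \<in> set cs" "paths_inv W (set cs) own r t D P"
    and rel: "relaxed W (set cs) own D P S D' P'"
  shows "\<exists>D'' P''. relaxed W (set cs) own D P (insert j S) D'' P'' \<and>
    steps m B Source
      (VPair (VPair (VPair (VNum (of_int j)) (owner_val (own j) j)) (VPair (VNum (D j)) (moves_val own r (P j))))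
        (VPair (paths_val own r D' P') u))
      (paths_val own r D'' P'') (300 * N + 350)"
proof (cases "own j")
  case None
  have "steps m B Source
      (VPair (VPair (VPair (VNum (of_int j)) (owner_val (own j) j)) (VPair (VNum (D j)) (moves_val own r (P j))))
        (VPair (paths_val own r D' P') u))
      (paths_val own r D' P') (300 * N + 350)"
    unfolding Source_def owner_val_def None option.case
    by (rule steps_weaken, (rule steps_If_False steps_rules)+) simp
  with relaxed_step_free[OF rel None] show ?thesis by blast
next
  case (Some i)
  have i: "i \<in> I" using Some assms(2) by (auto simp: ran_def)
  have P: "alt_path (set cs) own (P j)" "hd (P j) = j" "distinct (P j)" "D j = path_cost W own r (P j)"
    using assms(3,4) by (auto simp: paths_inv_def)
  \<comment> \<open>Here simplicity of the paths enters the size bound; without it the number of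
    operands could grow with the number of rounds and insertions.\<close>
  have "length (P j) \<le> N"
    using P(1,3) distinct_cs by (metis List.finite_set alt_path_def card_mono distinct_card)
  moreover have "fits m s (10 * length (P j) + 5) (D j - W i j)"
    unfolding P(4) using path_cost_fits[OF assms(1,2) P(1)] W_fits[OF i assms(3)] s_pos P(1)
    by (intro fits_diff) (auto simp: alt_path_def)
  ultimately have fits: "fits m s (10 * N + 5) (D j - W i j)"
    by (elim fits_mono) simp
  have size: "number_size m (D j - W i j) \<le> B"
    using fits by (rule fits_bounded) simp
  have ow: "owner_val (own j) j = VPair (VNum (W i j)) (VPair (out i j) (row_val i))"
    by (simp add: owner_val_def Some)
  have "steps m B Source
      (VPair (VPair (VPair (VNum (of_int j)) (owner_val (own j) j)) (VPair (VNum (D j)) (moves_val own r (P j))))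
        (VPair (paths_val own r D' P') u))
      (paths_val own r
       (\<lambda>k. if D j - W i j + W i k < D' k then D j - W i j + W i k else D' k)
       (\<lambda>k. if D j - W i j + W i k < D' k then k # P j else P' k)) (300 * N + 350)"
    unfolding Source_def ow
    apply (rule steps_weaken, (rule steps_If_True steps_rules)+)
    apply simp
    apply ((rule steps_rules steps_arith size)+)
    apply (rule steps_Relax[where D = D and P = P and own = own and j = j and b = "D j - W i j", OF Some i P(1,2) refl fits, unfolded ow])
    apply simp
    done
  with relaxed_step[OF rel assms(3) Some] show ?thesis by blast
qed

text \<open>The outer fold runs over the row of \<open>r\<close> merely to obtain \<open>N\<close>
  rounds; its elements are ignored. The potential \<open>v\<close> is unknown to the program and
  serves only to exclude negative cycles.\<close>

lemma steps_Shortest_Paths: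
  assumes "r \<in> I" "ran own \<subseteq> I" and v: "feasible_pot W (set cs) own v"
  shows "\<exists>D P. paths_inv W (set cs) own r N D P \<and>
    steps m B Shortest_Paths (VPair (row_val r) (VPair (matching_val own) u)) (paths_val own r D P)
      (N * (300 * (N + 1) ^ 2 + 300) + 300)"
proof -
  let ?env = "VPair (row_val r) (VPair (matching_val own) u)"
  let ?vs = "map (\<lambda>k. VPair (VNum (W r k)) (VPair (VNum (of_int k)) (out r k))) cs"
  let ?Q = "\<lambda>t w. \<exists>D P. w = paths_val own r D P \<and> paths_inv W (set cs) own r t D P"
  have init: "steps m B (Map V0 (Fork (hd_of V0) (Fork (Fork (hd_of (tl_of V0)) (Fork (hd_of V0) (Fork (tl_of (tl_of V0)) V2))) (Basic Empty))))
      ?env (paths_val own r (W r) (\<lambda>k. [k])) (120 * N + 80)"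
    apply (rule steps_cong, rule steps_Map[where n = 50])
    apply (subst row_val_def, rule steps_Head)
    apply (rule steps_weaken, (rule steps_rules)+)
    apply (simp_all add: paths_val_def moves_val_def owner_val_def)
    done
  have round: "\<exists>w'. steps m B (Fold (Zip V3 V1) V1 Source) (VPair e (VPair w ?env)) w' (300 * (N + 1) ^ 2) \<and> ?Q (Suc t) w'"
    if Q: "?Q t w" for t w e
  proof -
    obtain D P where w: "w = paths_val own r D P" and inv: "paths_inv W (set cs) own r t D P"
      using Q by blast
    let ?zs = "map (\<lambda>k. VPair (VPair (VNum (of_int k)) (owner_val (own k) k)) (VPair (VNum (D k)) (moves_val own r (P k)))) cs"
    let ?J = "\<lambda>l w. \<exists>D' P'. w = paths_val own r D' P' \<and> relaxed W (set cs) own D P (set (take l cs)) D' P'"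
    have "\<exists>w'. steps m B (Fold (Zip V3 V1) V1 Source) (VPair e (VPair w ?env)) w'
       ((20 + N * 100 + 100) + 3 + length ?zs * (300 * N + 350 + 20) + 20) \<and> ?J (length ?zs) w'"
    proof (rule steps_Fold_ex)
      show "steps m B (Zip V3 V1) (VPair e (VPair w ?env)) (vlist ?zs) (20 + N * 100 + 100)"
        unfolding w
        apply (rule steps_weaken, rule steps_Zip)
        apply ((rule steps_rules)+, subst matching_val_def, rule steps_rules)
        apply ((rule steps_rules)+, subst paths_val_def, rule steps_rules)
        apply simp
        done
      show "steps m B V1 (VPair e (VPair w ?env)) w 3"
        by (rule steps_weaken, (rule steps_rules)+) simp
      show "?J 0 w"
        using w relaxed_init[of W "set cs" own D P] by (simp only: take_0 list.set) blast
      fix l w' assume l: "l < length ?zs" and "?J l w'"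
      then obtain D' P' where w': "w' = paths_val own r D' P'"
        and rel: "relaxed W (set cs) own D P (set (take l cs)) D' P'" by blast
      have j: "cs ! l \<in> set cs" and ins: "insert (cs ! l) (set (take l cs)) = set (take (Suc l) cs)"
        using l by (simp_all add: take_Suc_conv_app_nth)
      have zs: "?zs ! l = VPair (VPair (VNum (of_int (cs ! l))) (owner_val (own (cs ! l)) (cs ! l)))
          (VPair (VNum (D (cs ! l))) (moves_val own r (P (cs ! l))))"
        using l by simp
      show "\<exists>w''. steps m B Source (VPair (?zs ! l) (VPair w' (VPair e (VPair w ?env)))) w'' (300 * N + 350) \<and> ?J (Suc l) w''"
        using steps_Source[OF assms(1,2) j inv rel, of "VPair e (VPair w ?env)"]
        unfolding w' zs ins by blast
    qed
    moreover have "(20 + N * 100 + 100) + 3 + length ?zs * (300 * N + 350 + 20) + 20 \<le> 300 * (N + 1) ^ 2"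
      by (simp add: power2_eq_square algebra_simps)
    ultimately obtain D' P' where "relaxed W (set cs) own D P (set cs) D' P'"
        "steps m B (Fold (Zip V3 V1) V1 Source) (VPair e (VPair w ?env)) (paths_val own r D' P') (300 * (N + 1) ^ 2)"
      by (auto intro: steps_weaken)
    with paths_inv_step[OF inv _ v] show ?thesis by blast
  qed
  have "\<exists>w. steps m B Shortest_Paths ?env w (1 + (120 * N + 80) + length ?vs * (300 * (N + 1) ^ 2 + 20) + 20) \<and> ?Q (length ?vs) w"
    unfolding Shortest_Paths_def
  proof (rule steps_Fold_ex[OF _ init])
    show "steps m B V0 ?env (vlist ?vs) 1"
      by (subst row_val_def, rule steps_Head)
    show "?Q 0 (paths_val own r (W r) (\<lambda>k. [k]))"
      by (rule exI[of _ "W r"], rule exI[of _ "\<lambda>k. [k]"], rule conjI[OF refl paths_inv_init])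
  qed (rule round)
  then obtain D P where "paths_inv W (set cs) own r N D P"
      "steps m B Shortest_Paths ?env (paths_val own r D P) (1 + (120 * N + 80) + N * (300 * (N + 1) ^ 2 + 20) + 20)"
    by auto
  moreover have "1 + (120 * N + 80) + N * (300 * (N + 1) ^ 2 + 20) + 20 \<le> N * (300 * (N + 1) ^ 2 + 300) + 300"
    by (simp add: distrib_left)
  ultimately show ?thesis
    using steps_weaken by blast
qed


lemma steps_Best:
  assumes "\<exists>k\<in>set cs. own k = None"
  shows "\<exists>j. j \<in> set cs \<and> own j = None \<and> (\<forall>k\<in>set cs. own k = None \<longrightarrow> D j \<le> D k) \<and>
    steps m B Best (VPair (paths_val own r D P) (VPair x (VPair (matching_val own) u)))
      (VPair (VNum (D j)) (moves_val own r (P j))) (250 * N + 250)"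
proof -
  let ?env = "VPair (paths_val own r D P) (VPair x (VPair (matching_val own) u))"
  let ?zs = "map (\<lambda>k. VPair (VPair (VNum (of_int k)) (owner_val (own k) k)) (VPair (VNum (D k)) (moves_val own r (P k)))) cs"
  let ?best = "\<lambda>j. VPair (VNum (D j)) (moves_val own r (P j))"
  \<comment> \<open>\<open>VNil\<close> stands for "no free column so far"; it cannot be confused
    with a candidate, which is a pair.\<close>
  let ?J = "\<lambda>l w. (w = VNil \<and> (\<forall>k\<in>set (take l cs). own k \<noteq> None)) \<or>
    (\<exists>j\<in>set cs. own j = None \<and> w = ?best j \<and> (\<forall>k\<in>set (take l cs). own k = None \<longrightarrow> D j \<le> D k))"
  have "\<exists>w. steps m B Best ?env w ((20 + N * 100 + 100) + 1 + length ?zs * (100 + 20) + 20) \<and> ?J (length ?zs) w"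
    unfolding Best_def
  proof (rule steps_Fold_ex)
    show "steps m B (Zip V2 V0) ?env (vlist ?zs) (20 + N * 100 + 100)"
      apply (rule steps_weaken, rule steps_Zip)
      apply ((rule steps_rules)+, subst matching_val_def, rule steps_rules)
      apply (subst paths_val_def, rule steps_rules)
      apply simp
      done
    show "steps m B (Basic Empty) ?env VNil 1"
      by (rule steps_rules)
    show "?J 0 VNil" by simp
    fix l w assume l: "l < length ?zs" and J: "?J l w"
    let ?k = "cs ! l"
    let ?body = "If (tl_of (hd_of V0)) V1 (If V1 (If (op2 Less (hd_of (tl_of V0)) (hd_of V1)) (tl_of V0) V1) (tl_of V0))"
    let ?z = "VPair (VPair (VNum (of_int ?k)) (owner_val (own ?k) ?k)) (?best ?k)"
    have k: "?k \<in> set cs" and ins: "set (take (Suc l) cs) = insert ?k (set (take l cs))"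
      using l by (simp_all add: take_Suc_conv_app_nth)
    have zs: "?zs ! l = ?z" using l by simp
    show "\<exists>w'. steps m B ?body (VPair (?zs ! l) (VPair w ?env)) w' 100 \<and> ?J (Suc l) w'"
      unfolding zs ins
    proof (cases "own ?k")
      case (Some i)
      have "steps m B ?body (VPair ?z (VPair w ?env)) w 100"
        unfolding Some owner_val_def option.case
        by (rule steps_weaken, (rule steps_If_True val.distinct steps_rules)+) simp_all
      moreover have "?J (Suc l) w"
        using J Some unfolding ins by auto
      ultimately show "\<exists>w'. steps m B ?body (VPair ?z (VPair w ?env)) w' 100 \<and> ((w' = VNil \<and> (\<forall>k\<in>insert ?k (set (take l cs)). own k \<noteq> None)) \<or>
    (\<exists>j\<in>set cs. own j = None \<and> w' = ?best j \<and> (\<forall>k\<in>insert ?k (set (take l cs)). own k = None \<longrightarrow> D j \<le> D k)))"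
        unfolding ins by blast
    next
      case None
      from J consider "w = VNil" "\<forall>k\<in>set (take l cs). own k \<noteq> None"
        | j where "j \<in> set cs" "own j = None" "w = ?best j" "\<forall>k\<in>set (take l cs). own k = None \<longrightarrow> D j \<le> D k"
        by blast
      then show "\<exists>w'. steps m B ?body (VPair ?z (VPair w ?env)) w' 100 \<and> ((w' = VNil \<and> (\<forall>k\<in>insert ?k (set (take l cs)). own k \<noteq> None)) \<or>
    (\<exists>j\<in>set cs. own j = None \<and> w' = ?best j \<and> (\<forall>k\<in>insert ?k (set (take l cs)). own k = None \<longrightarrow> D j \<le> D k)))"
      proof cases
        case 1
        have "steps m B ?body (VPair ?z (VPair w ?env)) (?best ?k) 100"
          unfolding None owner_val_def option.case 1(1)
          by (rule steps_weaken, (rule steps_If_False steps_rules)+) simp_all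
        then show ?thesis using 1 k None by blast
      next
        case (2 j)
        have "steps m B ?body (VPair ?z (VPair w ?env)) (if D ?k < D j then ?best ?k else ?best j) 100"
          unfolding None owner_val_def option.case 2(3)
          apply (rule steps_weaken, rule steps_If_False, (rule steps_rules)+)
          apply (rule steps_If_True, (rule steps_rules)+, simp, rule steps_If_bool)
          apply ((rule steps_rules)+)
          apply simp
          done
        then show ?thesis using 2 k None by (cases "D ?k < D j") fastforce+
      qed
    qed
  qed
  then obtain w where w: "steps m B Best ?env w (20 + N * 100 + 100 + 1 + length ?zs * (100 + 20) + 20)"
    and J: "?J (length ?zs) w" by blast
  from J assms obtain j where "j \<in> set cs" "own j = None" "w = ?best j" "\<forall>k\<in>set cs. own k = None \<longrightarrow> D j \<le> D k"
    by auto
  moreover have "steps m B Best ?env w (250 * N + 250)"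
    using w by (rule steps_weaken) simp
  ultimately show ?thesis by blast
qed

lemma steps_Update:
  assumes "distinct p" "length p \<le> N"
  shows "steps m B Update (VPair (VPair (VNum d) (moves_val own r p)) (VPair x (VPair y (VPair (matching_val own) u))))
    (matching_val (own ++ map_of (moves own r p))) (N * (100 * N + 200) + 100)"
proof -
  let ?env = "VPair (VPair (VNum d) (moves_val own r p)) (VPair x (VPair y (VPair (matching_val own) u)))"
  let ?mv = "moves own r p"
  let ?vs = "map (\<lambda>(k, i). VPair (VNum (of_int k)) (owner_val (Some i) k)) ?mv"
  have entry: "steps m B (Fold (tl_of V2) V0 (If (Eq (hd_of V0) (hd_of V2)) V0 V1))
      (VPair (VPair (VNum (of_int c)) (owner_val (own c) c)) (VPair a ?env))
      (VPair (VNum (of_int c)) (owner_val ((own ++ map_of ?mv) c) c)) (N * 100 + 50)" for c a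
  proof -
    let ?A = "\<lambda>t. VPair (VNum (of_int c)) (owner_val ((own ++ map_of (take t ?mv)) c) c)"
    let ?e = "VPair (VPair (VNum (of_int c)) (owner_val (own c) c)) (VPair a ?env)"
    have fold: "steps m B (Fold (tl_of V2) V0 (If (Eq (hd_of V0) (hd_of V2)) V0 V1)) ?e
       (?A (length ?vs)) (7 + 1 + length ?vs * (80 + 20) + 20)"
    proof (rule steps_Fold[where A = ?A])
      show "steps m B (tl_of V2) ?e (vlist ?vs) 7"
        by (rule steps_cong, (rule steps_rules)+) (simp_all add: moves_val_def)
      show "steps m B V0 ?e (?A 0) 1"
        by (rule steps_cong, rule steps_rules) simp_all
      fix t assume t: "t < length ?vs"
      obtain k i where ki: "?mv ! t = (k, i)" by fastforce
      \<comment> \<open>The loop lets the last matching move win, \<open>map_of\<close> the first.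
        They agree because no column is moved twice.\<close>
      have "distinct (map fst (take (Suc t) ?mv))"
        using assms(1) by (metis distinct_take map_fst_moves take_map)
      then have "k \<notin> fst ` set (take t ?mv)"
        using t ki by (simp add: take_Suc_conv_app_nth)
      then have mt: "map_of (take (Suc t) ?mv) c = (if k = c then Some i else map_of (take t ?mv) c)"
        using t ki map_of_eq_None_iff[of "take t ?mv" k]
        by (auto simp: take_Suc_conv_app_nth map_add_def split: option.split)
      have vt: "?vs ! t = VPair (VNum (of_int k)) (owner_val (Some i) k)"
        using t ki by simp
      show "steps m B (If (Eq (hd_of V0) (hd_of V2)) V0 V1) (VPair (?vs ! t) (VPair (?A t) ?e)) (?A (Suc t)) 80"
        unfolding vt
        apply (rule steps_cong, rule steps_If_bool, rule steps_Eq)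
        apply ((rule steps_rules)+)
        apply (simp_all add: mt map_add_def)
        done
    qed
    have "length ?mv = length p"
      by (metis length_map map_fst_moves)
    then show ?thesis
      by (intro steps_cong[OF fold]) (use assms(2) in simp_all)
  qed
  show ?thesis
    unfolding Update_def
    apply (rule steps_cong, rule steps_Map)
    apply ((rule steps_rules)+, subst matching_val_def, rule steps_rules)
    apply (rule entry)
    apply (simp_all add: matching_val_def algebra_simps)
    done
qed

lemma steps_Insert:
  assumes cert: "certified W (set cs) R own" and r: "r \<notin> R" and R_I: "insert r R \<subseteq> I" and free: "card R < N"
  shows "\<exists>own'. certified W (set cs) (insert r R) own' \<and>
    steps m B Insert (VPair (row_val r) (VPair (matching_val own) u)) (matching_val own') (2000 * (N + 1) ^ 3)"
proof -
  obtain v where v: "feasible_pot W (set cs) own v" and own: "owners (set cs) R own"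
    using cert by (auto simp: certified_def)
  have rI: "r \<in> I" "ran own \<subseteq> I"
    using own R_I by (auto simp: owners_def)
  obtain D P where inv: "paths_inv W (set cs) own r N D P" and
    sp: "steps m B Shortest_Paths (VPair (row_val r) (VPair (matching_val own) u)) (paths_val own r D P)
      (N * (300 * (N + 1) ^ 2 + 300) + 300)"
    using steps_Shortest_Paths[OF rI v, of u] by blast
  have "\<exists>k\<in>set cs. own k = None"
    using owners_free_column[OF own] free distinct_cs by (auto simp: distinct_card dom_def)
  from steps_Best[OF this] obtain j where j: "j \<in> set cs" "own j = None" "\<And>k. k \<in> set cs \<Longrightarrow> own k = None \<Longrightarrow> D j \<le> D k"
    and best: "steps m B Best (VPair (paths_val own r D P) (VPair (row_val r) (VPair (matching_val own) u)))
      (VPair (VNum (D j)) (moves_val own r (P j))) (250 * N + 250)"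
    by blast
  have P: "alt_path (set cs) own (P j)" "hd (P j) = j" "distinct (P j)" "D j = path_cost W own r (P j)"
    using inv j(1) by (auto simp: paths_inv_def)
  have len: "length (P j) \<le> N"
    using P(1,3) distinct_cs by (metis List.finite_set alt_path_def card_mono distinct_card)
  have "certified W (set cs) (insert r R) (own ++ map_of (moves own r (P j)))"
  proof (rule certified_augment[OF cert r])
    show "feasible_pot W (set cs) own D"
      using paths_inv_feasible_pot[of W "set cs" own r D P] inv own distinct_cs
      by (auto simp: owners_def distinct_card)
  qed (use paths_inv_le_row[OF inv] P j in auto)
  moreover have "steps m B Insert (VPair (row_val r) (VPair (matching_val own) u))
      (matching_val (own ++ map_of (moves own r (P j)))) (2000 * (N + 1) ^ 3)"
    unfolding Insert_def
    apply (rule steps_weaken, (rule steps_Seq steps_Fork steps_Copy sp best steps_Update[OF P(3) len])+)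
    apply (simp add: power2_eq_square power3_eq_cube algebra_simps)
    done
  ultimately show ?thesis by blast
qed

end

section \<open>Offers as columns\<close>

text \<open>
  Column \<open>k \<ge> 0\<close> is the driver \<open>k\<close>. Column \<open>-1 - i\<close> stands for a professional driver; there is
  one for each task, but any of them may serve any task.
\<close>

definition offer_columns :: "capcab \<Rightarrow> int list" where
  "offer_columns X = rev (map (\<lambda>i. - 1 - int i) (sorted_list_of_set (tasks X))) @
     map int (sorted_list_of_set (drivers X))"

definition offer_cost :: "capcab \<Rightarrow> (nat \<Rightarrow> nat \<Rightarrow> real) \<Rightarrow> nat \<Rightarrow> int \<Rightarrow> real" where
  "offer_cost X C i k = (if k < 0 then cost X i else
     acceptance X i (nat k) (C i (nat k)) * C i (nat k) +
     (1 - acceptance X i (nat k) (C i (nat k))) * penalized_cost X i)"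

text \<open>The value \<open>VNil\<close> marks a professional driver, so that \<open>Output\<close>
  can drop the column with a single test.\<close>

definition offer_val :: "(nat \<Rightarrow> nat \<Rightarrow> real) \<Rightarrow> nat \<Rightarrow> int \<Rightarrow> val" where
  "offer_val C i k = (if k < 0 then VNil else vlist [vnat i, VNum (of_int k), VNum (C i (nat k))])"

definition offers_of :: "nat set \<Rightarrow> (nat \<Rightarrow> int) \<Rightarrow> offers" where
  "offers_of T f = (\<lambda>i. (i, nat (f i))) ` {i\<in>T. 0 \<le> f i}"

lemma set_offer_columns:
  assumes "capcab_instance X"
  shows "set (offer_columns X) = (\<lambda>i. - 1 - int i) ` tasks X \<union> int ` drivers X"
  using assms by (simp add: offer_columns_def capcab_instance_def)

lemma distinct_offer_columns: "distinct (offer_columns X)"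
  by (auto simp: offer_columns_def distinct_map inj_on_def)

lemma length_offer_columns: "length (offer_columns X) = card (tasks X) + card (drivers X)"
  by (simp add: offer_columns_def)

lemma offers_of_assignment:
  assumes "capcab_instance X" "inj_on f (tasks X)" "f ` tasks X \<subseteq> set (offer_columns X)"
  shows "is_assignment X (offers_of (tasks X) f)"
proof -
  have "nat (f i) \<in> drivers X" if "i \<in> tasks X" "0 \<le> f i" for i
    using assms(3) that set_offer_columns[OF assms(1)] by fastforce
  moreover have "inj_on snd (offers_of (tasks X) f)"
    using assms(2) by (auto simp: offers_of_def inj_on_def)
  ultimately show ?thesis
    by (auto simp: is_assignment_def offers_of_def inj_on_def)
qed

lemma expected_cost_offers_of:
  assumes X: "capcab_instance X" "separable X"
    and sol: "is_solution X (offers_of (tasks X) f) C"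
  shows "expected_cost X (offers_of (tasks X) f) C = (\<Sum>i\<in>tasks X. offer_cost X C i (f i))"
proof -
  let ?S = "{i \<in> tasks X. 0 \<le> f i}"
  have fin: "finite (tasks X)" using X(1) by (simp add: capcab_instance_def)
  have fst: "fst ` offers_of (tasks X) f = ?S"
    by (force simp: offers_of_def)
  have inj: "inj_on (\<lambda>i. (i, nat (f i))) ?S"
    by (simp add: inj_on_def)
  have "expected_cost X (offers_of (tasks X) f) C =
      (\<Sum>i\<in>tasks X - ?S. cost X i) + (\<Sum>i\<in>?S. offer_cost X C i (f i))"
    unfolding separable_expected_cost[OF X sol] fst
    unfolding offers_of_def sum.reindex[OF inj]
    by (auto simp: offer_cost_def intro!: sum.cong)
  also have "(\<Sum>i\<in>tasks X - ?S. cost X i) = (\<Sum>i\<in>tasks X - ?S. offer_cost X C i (f i))"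
    by (intro sum.cong) (auto simp: offer_cost_def)
  also have "\<dots> + (\<Sum>i\<in>?S. offer_cost X C i (f i)) = (\<Sum>i\<in>tasks X. offer_cost X C i (f i))"
    using sum.subset_diff[of ?S "tasks X"] fin by (metis (no_types, lifting) mem_Collect_eq subsetI)
  finally show ?thesis .
qed

lemma assignment_offers_of:
  assumes X: "capcab_instance X" and A: "is_assignment X A"
  obtains f where "A = offers_of (tasks X) f" "inj_on f (tasks X)" "f ` tasks X \<subseteq> set (offer_columns X)"
proof
  \<comment> \<open>A task without an offer goes to the professional column with its own number.
    Idle tasks are thereby kept apart from each other and from the offered ones.\<close>
  define f where "f i = (if \<exists>j. (i, j) \<in> A then int (THE j. (i, j) \<in> A) else - 1 - int i)" for i
  have sub: "A \<subseteq> tasks X \<times> drivers X"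
    using A by (simp add: is_assignment_def)
  have the: "(THE j. (i, j) \<in> A) = j" if "(i, j) \<in> A" for i j
  proof (rule the_equality)
    show "(i, j) \<in> A" by (rule that)
    fix j' assume "(i, j') \<in> A"
    then show "j' = j"
      using inj_onD[of fst A "(i, j')" "(i, j)"] that A by (simp add: is_assignment_def)
  qed
  have f_in: "f i = int j" if "(i, j) \<in> A" for i j
    using the[OF that] that by (auto simp: f_def)
  have f_out: "f i = - 1 - int i" if "\<nexists>j. (i, j) \<in> A" for i
    using that by (simp add: f_def)
  have f_nonneg: "\<exists>j. (i, j) \<in> A" if "0 \<le> f i" for i
    by (rule ccontr) (use f_out[of i] that in simp)
  show "A = offers_of (tasks X) f"
  proof (intro equalityI subsetI)
    fix p assume p: "p \<in> A"
    obtain i j where ij: "p = (i, j)" by fastforce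
    have "i \<in> tasks X" "f i = int j"
      using p sub f_in[of i j] by (auto simp: ij)
    then show "p \<in> offers_of (tasks X) f"
      unfolding offers_of_def by (intro image_eqI[of _ _ i]) (simp_all add: ij)
  next
    fix p assume "p \<in> offers_of (tasks X) f"
    then obtain i where i: "p = (i, nat (f i))" "0 \<le> f i" by (auto simp: offers_of_def)
    then obtain j where "(i, j) \<in> A" using f_nonneg by blast
    then show "p \<in> A" using f_in[of i j] i by simp
  qed
  show "inj_on f (tasks X)"
  proof (rule inj_onI)
    fix i i' assume eq: "f i = f i'"
    show "i = i'"
    proof (cases "0 \<le> f i")
      case True
      then have "0 \<le> f i'" using eq by simp
      then obtain j j' where j: "(i, j) \<in> A" "(i', j') \<in> A"
        using f_nonneg True by blast
      then have "j = j'"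
        using f_in[of i j] f_in[of i' j'] eq by simp
      then show ?thesis
        using inj_onD[of snd A "(i, j)" "(i', j')"] j A by (simp add: is_assignment_def)
    next
      case False
      have neg: "f l = - 1 - int l" if "f l < 0" for l
      proof (rule f_out, rule notI)
        assume "\<exists>j. (l, j) \<in> A"
        then obtain j where "(l, j) \<in> A" by blast
        then show False using f_in[of l j] that by simp
      qed
      show ?thesis using neg[of i] neg[of i'] eq False by simp
    qed
  qed
  show "f ` tasks X \<subseteq> set (offer_columns X)"
  proof
    fix k assume "k \<in> f ` tasks X"
    then obtain i where i: "i \<in> tasks X" "k = f i" by blast
    show "k \<in> set (offer_columns X)"
    proof (cases "\<exists>j. (i, j) \<in> A")
      case True
      then obtain j where "(i, j) \<in> A" by blast
      then show ?thesis using i f_in[of i j] sub by (auto simp: set_offer_columns[OF X])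
    next
      case False
      then show ?thesis using i f_out[of i] by (auto simp: set_offer_columns[OF X])
    qed
  qed
qed

text \<open>For a driver the cost is c' + P(C) (C - c'), whose second summand is what an optimal
  compensation minimises; a professional column does not depend on the compensation.\<close>

lemma offer_cost_le:
  assumes "\<And>j. int j = k \<Longrightarrow> optimal_compensation X i j (C i j) \<and> 0 \<le> C' i j"
  shows "offer_cost X C i k \<le> offer_cost X C' i k"
proof (cases "k < 0")
  case False
  then have "optimal_compensation X i (nat k) (C i (nat k))" "0 \<le> C' i (nat k)"
    using assms[of "nat k"] by auto
  then have "acceptance X i (nat k) (C i (nat k)) * (C i (nat k) - penalized_cost X i) \<le>
      acceptance X i (nat k) (C' i (nat k)) * (C' i (nat k) - penalized_cost X i)"
    unfolding optimal_compensation_def is_arg_min_def by (meson not_less)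
  then show ?thesis using False by (simp add: offer_cost_def algebra_simps)
qed (simp add: offer_cost_def)

text \<open>A competitor is compared in two stages: first its assignment with the certified one,
  both at the compensations \<open>C\<close>, and then \<open>C\<close> with its own compensations
  at its own assignment. Separability makes both costs sums over tasks and every solution
  feasible.\<close>

lemma certified_offers_optimal:
  assumes X: "capcab_instance X" "separable X"
    and C: "\<And>i j. i \<in> tasks X \<Longrightarrow> j \<in> drivers X \<Longrightarrow> optimal_compensation X i j (C i j)"
    and cert: "certified (offer_cost X C) (set (offer_columns X)) (tasks X) own"
  shows "optimal X {(i, nat k) | i k. own k = Some i \<and> 0 \<le> k} C"
proof -
  have own: "dom own \<subseteq> set (offer_columns X)" "inj_on own (dom own)" "ran own = tasks X"
    using cert by (auto simp: certified_def owners_def)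
  have "\<exists>k. own k = Some i" if "i \<in> tasks X" for i
    using own(3) that by (auto simp: ran_def)
  then obtain g where g: "own (g i) = Some i" if "i \<in> tasks X" for i
    by metis
  have g_unique: "g i = k" "i \<in> tasks X" if "own k = Some i" for k i
  proof -
    show i: "i \<in> tasks X" using own(3) that by (auto simp: ran_def)
    show "g i = k" using g[OF i] own(2) that by (auto simp: inj_on_def dom_def)
  qed
  have A: "{(i, nat k) | i k. own k = Some i \<and> 0 \<le> k} = offers_of (tasks X) g"
    using g g_unique by (force simp: offers_of_def)
  have g_inj: "inj_on g (tasks X)"
    by (metis g inj_onI option.inject)
  have g_cols: "g ` tasks X \<subseteq> set (offer_columns X)"
    using g own(1) by blast
  have fin: "finite (set (offer_columns X))" "finite (tasks X)"
    using X(1) by (auto simp: capcab_instance_def)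
  have asg: "is_assignment X (offers_of (tasks X) g)"
    using offers_of_assignment[OF X(1) g_inj g_cols] .
  have "0 \<le> C i j" if "(i, j) \<in> offers_of (tasks X) g" for i j
    using C[of i j] asg that by (auto simp: is_assignment_def optimal_compensation_def is_arg_min_def)
  then have sol: "is_solution X (offers_of (tasks X) g) C"
    using asg by (auto simp: is_solution_def)
  have feas: "feasible X (offers_of (tasks X) g) C"
    using sol X(2) by (simp add: feasible_def separable_def)
  have "expected_cost X (offers_of (tasks X) g) C \<le> expected_cost X A' C'" if "feasible X A' C'" for A' C'
  proof -
    have sol': "is_solution X A' C'" using that by (simp add: feasible_def)
    then obtain f where f: "A' = offers_of (tasks X) f" "inj_on f (tasks X)" "f ` tasks X \<subseteq> set (offer_columns X)"
      using assignment_offers_of[OF X(1)] by (metis is_solution_def)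
    have "expected_cost X (offers_of (tasks X) g) C = (\<Sum>i\<in>tasks X. offer_cost X C i (g i))"
      using expected_cost_offers_of[OF X sol] .
    also have "\<dots> \<le> (\<Sum>i\<in>tasks X. offer_cost X C i (f i))"
      using certified_optimal[OF cert fin g f(2,3)] .
    also have "\<dots> \<le> (\<Sum>i\<in>tasks X. offer_cost X C' i (f i))"
    proof (rule sum_mono, rule offer_cost_le)
      fix i j assume i: "i \<in> tasks X" and j: "int j = f i"
      then have "(i, j) \<in> A'"
        unfolding f(1) offers_of_def by force
      then show "optimal_compensation X i j (C i j) \<and> 0 \<le> C' i j"
        using sol' C[of i j] by (auto simp: is_solution_def is_assignment_def)
    qed
    also have "\<dots> = expected_cost X A' C'"
      using expected_cost_offers_of[OF X] sol' f(1) by metis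
    finally show ?thesis .
  qed
  then show ?thesis
    using feas unfolding A optimal_def is_arg_min_def by (auto simp: not_less)
qed

section \<open>The program\<close>

definition Columns :: prog where
  "Columns = Fold (hd_of V0) (hd_of (tl_of V0)) (Fork (op2 Minus (Basic (Lit (-1))) (hd_of V0)) V1)"

text \<open>\<open>V5\<close> and \<open>V6\<close> both denote the instance: each
  \<open>Let_in\<close> shifts the environment by one. The same holds for \<open>V2\<close>,
  \<open>V3\<close>, \<open>V4\<close>, which denote the task at the three depths outside, between
  and inside the two calls.\<close>

definition Edges :: "prog \<Rightarrow> prog \<Rightarrow> prog" where
  "Edges pC pP = Map V2
     (If (op2 Less V0 (Basic (Lit 0)))
        (Fork (hd_of (tl_of V2)) (Fork V0 (Basic Empty)))
        (Let_in (Seq (Fork V5 (Fork (hd_of V2) (Fork V0 (Basic Empty)))) pC)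
           (Let_in (Seq (Fork V6 (Fork (hd_of V3) (Fork V1 (Fork V0 (Basic Empty))))) pP)
              (Fork
                 (op2 Plus (op2 Times V0 V1) (op2 Times (op2 Minus (Basic (Lit 1)) V0) (hd_of (tl_of (tl_of V4)))))
                 (Fork V2 (Fork (hd_of V4) (Fork V2 (Fork V1 (Basic Empty)))))))))"

text \<open>The outer test skips free columns, the inner one professional columns, whose output item
  is \<open>VNil\<close>.\<close>

definition Output :: "prog \<Rightarrow> prog" where
  "Output p = Fold p (Basic Empty)
     (If (tl_of V0) (If (hd_of (tl_of (tl_of V0))) (Fork (hd_of (tl_of (tl_of V0))) V1) V1) V1)"

definition Solve :: "prog \<Rightarrow> prog \<Rightarrow> prog" where
  "Solve pC pP = Seq (Fork (Basic Copy) (Basic Empty)) (Let_in Columns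
     (Output (Fold (hd_of V1) (Map V0 (Fork V0 (Basic Empty))) (Seq (Fork (Edges pC pP) (Basic Tail)) Insert))))"

definition task_val :: "capcab \<Rightarrow> nat \<Rightarrow> val" where
  "task_val X i = vlist [vnat i, VNum (cost X i), VNum (penalized_cost X i)]"

lemma enc_instance_eq: "enc_instance (X, d) =
    VPair (vlist (map (task_val X) (sorted_list_of_set (tasks X))))
      (VPair (vlist (map vnat (sorted_list_of_set (drivers X)))) (VPair d VNil))"
  by (simp add: enc_instance_def task_val_def[abs_def])

locale solver =
  fixes m :: cost_model and B s :: nat and X :: capcab and d :: val
    and C :: "nat \<Rightarrow> nat \<Rightarrow> real" and pC pP :: prog and nC nP :: nat
  assumes X: "capcab_instance X"
    and run_pC: "\<And>i j. i \<in> tasks X \<Longrightarrow> j \<in> drivers X \<Longrightarrow>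
      steps m B pC (vlist [enc_instance (X, d), vnat i, vnat j]) (VNum (C i j)) nC"
    and run_pP: "\<And>i j. i \<in> tasks X \<Longrightarrow> j \<in> drivers X \<Longrightarrow>
      steps m B pP (vlist [enc_instance (X, d), vnat i, vnat j, VNum (C i j)]) (VNum (acceptance X i j (C i j))) nP"
    and fits_task: "\<And>i. i \<in> tasks X \<Longrightarrow> fits m s 1 (real i) \<and> fits m s 1 (cost X i) \<and> fits m s 1 (penalized_cost X i)"
    and fits_offer: "\<And>i j. i \<in> tasks X \<Longrightarrow> j \<in> drivers X \<Longrightarrow>
      fits m s 1 (C i j) \<and> fits m s 1 (acceptance X i j (C i j))"
    and fits_one: "fits m s 1 1" and s_gt_0: "0 < s"
    and B_ge: "30 * s * (length (offer_columns X) + 1) + 2 \<le> B"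
begin

lemma fin: "finite (tasks X)" "finite (drivers X)"
  using X by (simp_all add: capcab_instance_def)

lemma column_cases:
  assumes "k \<in> set (offer_columns X)"
  obtains "k < 0" | j where "j \<in> drivers X" "k = int j"
  using assms by (auto simp: set_offer_columns[OF X])

lemma offer_arith_fits:
  assumes "i \<in> tasks X" "j \<in> drivers X"
  shows "fits m s 2 (acceptance X i j (C i j) * C i j)"
    "fits m s 2 (1 - acceptance X i j (C i j))"
    "fits m s 3 ((1 - acceptance X i j (C i j)) * penalized_cost X i)"
    "fits m s 5 (acceptance X i j (C i j) * C i j + (1 - acceptance X i j (C i j)) * penalized_cost X i)"
proof -
  note f = fits_task[OF assms(1)] fits_offer[OF assms]
  show 1: "fits m s 2 (acceptance X i j (C i j) * C i j)"
    using f fits_mult[of m s 1 _ 1] by (simp del: One_nat_def)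
  show 2: "fits m s 2 (1 - acceptance X i j (C i j))"
    using f fits_one s_gt_0 fits_diff[of m s 1 _ 1] by (simp del: One_nat_def)
  show 3: "fits m s 3 ((1 - acceptance X i j (C i j)) * penalized_cost X i)"
    using f 2 fits_mult[of m s 2 _ 1] by (simp del: One_nat_def)
  show "fits m s 5 (acceptance X i j (C i j) * C i j + (1 - acceptance X i j (C i j)) * penalized_cost X i)"
    using fits_add[OF 1 3] s_gt_0 by simp
qed

sublocale bounded_encoding "offer_cost X C" "offer_val C" "offer_columns X" m B s "tasks X"
proof
  fix i k assume i: "i \<in> tasks X" and "k \<in> set (offer_columns X)"
  then show "fits m s 5 (offer_cost X C i k)"
    using offer_arith_fits(4)[OF i] fits_mono[of m s 1 _ 5] fits_task[OF i]
    by (elim column_cases) (auto simp: offer_cost_def)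
qed (use distinct_offer_columns s_gt_0 B_ge in auto)

lemma fits_le_B: "fits m s k x \<Longrightarrow> k \<le> 10 \<Longrightarrow> number_size m x \<le> B"
  by (rule fits_bounded) auto

lemma steps_Columns:
  "steps m B Columns (VPair (enc_instance (X, d)) u) (vlist (map (\<lambda>k. VNum (of_int k)) (offer_columns X)))
     (50 * N + 50)"
proof -
  let ?ts = "sorted_list_of_set (tasks X)"
  \<comment> \<open>Every step pushes a professional column onto the front of the drivers, which
    explains the \<open>rev\<close> in \<open>offer_columns\<close>.\<close>
  let ?A = "\<lambda>l. vlist (map (\<lambda>k. VNum (of_int k)) (rev (map (\<lambda>i. - 1 - int i) (take l ?ts)) @ map int (sorted_list_of_set (drivers X))))"
  have "steps m B Columns (VPair (enc_instance (X, d)) u) (?A (length (map (task_val X) ?ts)))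
     (5 + 5 + length (map (task_val X) ?ts) * (30 + 20) + 20)"
    unfolding Columns_def
  proof (rule steps_Fold[where A = ?A])
    show "steps m B (hd_of V0) (VPair (enc_instance (X, d)) u) (vlist (map (task_val X) ?ts)) 5"
      unfolding enc_instance_eq by (rule steps_weaken, (rule steps_rules)+) simp
    show "steps m B (hd_of (tl_of V0)) (VPair (enc_instance (X, d)) u) (?A 0) 5"
      unfolding enc_instance_eq by (rule steps_cong, (rule steps_rules)+) (simp_all add: comp_def)
    fix l assume l: "l < length (map (task_val X) ?ts)"
    then have "?ts ! l \<in> tasks X"
      using fin nth_mem[of l ?ts] by (simp del: nth_mem)
    then have size: "number_size m (- 1 - real (?ts ! l)) \<le> B"
      using fits_diff[OF fits_uminus[OF fits_one]] fits_task s_gt_0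
      by (intro fits_le_B[of "1 + 1"]) auto
    have val: "map (task_val X) ?ts ! l = VPair (vnat (?ts ! l)) (VPair (VNum (cost X (?ts ! l))) (VPair (VNum (penalized_cost X (?ts ! l))) VNil))"
      using l by (simp add: task_val_def)
    show "steps m B (Fork (op2 Minus (Basic (Lit (-1))) (hd_of V0)) V1)
      (VPair (map (task_val X) ?ts ! l) (VPair (?A l) (VPair (enc_instance (X, d)) u))) (?A (Suc l)) 30"
      unfolding val
      by (rule steps_cong, (rule steps_rules steps_arith size)+) (use l in \<open>simp_all add: take_Suc_conv_app_nth\<close>)
  qed
  then show ?thesis
    by (rule steps_cong) (simp_all add: offer_columns_def)
qed

lemma steps_Edges:
  assumes i: "i \<in> tasks X"
  shows "steps m B (Edges pC pP)
    (VPair (task_val X i) (VPair w (VPair (vlist (map (\<lambda>k. VNum (of_int k)) (offer_columns X))) (VPair (enc_instance (X, d)) u))))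
    (row_val i) (N * (nC + nP + 400) + 100)"
proof -
  let ?cols = "vlist (map (\<lambda>k. VNum (of_int k)) (offer_columns X))"
  let ?env = "VPair (task_val X i) (VPair w (VPair ?cols (VPair (enc_instance (X, d)) u)))"
  have body: "steps m B (If (op2 Less V0 (Basic (Lit 0)))
        (Fork (hd_of (tl_of V2)) (Fork V0 (Basic Empty)))
        (Let_in (Seq (Fork V5 (Fork (hd_of V2) (Fork V0 (Basic Empty)))) pC)
           (Let_in (Seq (Fork V6 (Fork (hd_of V3) (Fork V1 (Fork V0 (Basic Empty))))) pP)
              (Fork
                 (op2 Plus (op2 Times V0 V1) (op2 Times (op2 Minus (Basic (Lit 1)) V0) (hd_of (tl_of (tl_of V4)))))
                 (Fork V2 (Fork (hd_of V4) (Fork V2 (Fork V1 (Basic Empty)))))))))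
      (VPair (VNum (of_int k)) (VPair a ?env))
      (VPair (VNum (offer_cost X C i k)) (VPair (VNum (of_int k)) (offer_val C i k))) (nC + nP + 300)" (is "steps m B ?p ?e ?r _")
    if "k \<in> set (offer_columns X)" for k a
    using that
  proof (cases rule: column_cases)
    case 1
    then have neg: "vbool (real_of_int k < 0) \<noteq> VNil" by (simp add: vbool_def)
    show ?thesis
      unfolding task_val_def vlist.simps
      by (rule steps_cong, (rule steps_If_True neg steps_rules)+)
        (use 1 in \<open>simp_all add: offer_cost_def offer_val_def\<close>)
  next
    case (2 j)
    then have neg: "vbool (real j < 0) = VNil" by (simp add: vbool_def)
    note sizes = offer_arith_fits[OF i 2(1), THEN fits_le_B, simplified]
    have cond: "steps m B (op2 Less V0 (Basic (Lit 0))) (VPair (vnat j) (VPair a ?env)) VNil 5"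
      by (rule steps_cong, (rule steps_rules)+) (use neg in simp_all)
    note calls = run_pC[OF i 2(1), unfolded vlist.simps] run_pP[OF i 2(1), unfolded vlist.simps]
    show ?thesis
      unfolding task_val_def vlist.simps 2(2) of_int_of_nat_eq
      by (rule steps_cong, rule steps_If_False, rule cond[unfolded task_val_def vlist.simps],
          (rule calls steps_rules steps_arith sizes)+)
        (simp_all add: offer_cost_def offer_val_def)
  qed
  show ?thesis
    unfolding Edges_def
    apply (rule steps_cong, rule steps_Map)
    apply ((rule steps_rules)+)
    apply (rule body, assumption)
    apply (simp_all add: row_val_def algebra_simps)
    done
qed

lemma steps_Output:
  assumes own: "dom own \<subseteq> set (offer_columns X)"
    and p: "steps m B p u (matching_val own) n"
  shows "\<exists>os. set os = {(i, nat k) | i k. own k = Some i \<and> 0 \<le> k} \<and> length os \<le> N \<and>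
    steps m B (Output p) u (vlist (map (\<lambda>(i, j). vlist [vnat i, vnat j, VNum (C i j)]) os)) (n + 100 * N + 100)"
proof -
  let ?vs = "map (\<lambda>k. VPair (VNum (of_int k)) (owner_val (own k) k)) (offer_columns X)"
  let ?enc = "map (\<lambda>(i, j). vlist [vnat i, vnat j, VNum (C i j)])"
  let ?os = "\<lambda>l. map (\<lambda>k. (the (own k), nat k)) (rev (filter (\<lambda>k. 0 \<le> k \<and> own k \<noteq> None) (take l (offer_columns X))))"
  have "steps m B (Output p) u (vlist (?enc (?os (length ?vs)))) (n + 1 + length ?vs * (80 + 20) + 20)"
    unfolding Output_def
  proof (rule steps_Fold[where A = "\<lambda>l. vlist (?enc (?os l))"])
    show "steps m B p u (vlist ?vs) n"
      using p by (simp add: matching_val_def)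
    show "steps m B (Basic Empty) u (vlist (?enc (?os 0))) 1"
      by (rule steps_cong, rule steps_rules) simp_all
    fix l assume l: "l < length ?vs"
    let ?k = "offer_columns X ! l"
    let ?e = "VPair (?vs ! l) (VPair (vlist (?enc (?os l))) u)"
    let ?body = "If (tl_of V0) (If (hd_of (tl_of (tl_of V0))) (Fork (hd_of (tl_of (tl_of V0))) V1) V1) V1"
    have v: "?vs ! l = VPair (VNum (of_int ?k)) (owner_val (own ?k) ?k)" using l by simp
    have Suc: "take (Suc l) (offer_columns X) = take l (offer_columns X) @ [?k]"
      using l by (simp add: take_Suc_conv_app_nth)
    show "steps m B ?body ?e (vlist (?enc (?os (Suc l)))) 80"
    proof (cases "own ?k")
      case None
      show ?thesis
        unfolding v unfolding None owner_val_def option.case Suc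
        by (rule steps_cong, (rule steps_If_False steps_rules)+) (simp_all add: None)
    next
      case (Some i)
      show ?thesis
      proof (cases "?k < 0")
        case True
        then have o: "offer_val C i ?k = VNil" by (simp add: offer_val_def)
        show ?thesis
          unfolding v unfolding Some owner_val_def option.case Suc o
          apply (rule steps_cong, rule steps_If_True, (rule steps_rules)+, simp, rule steps_If_False)
          apply ((rule steps_rules)+)
          apply (use True in simp_all)
          done
      next
        case False
        then have o: "offer_val C i ?k = VPair (vnat i) (VPair (VNum (of_int ?k)) (VPair (VNum (C i (nat ?k))) VNil))"
          by (simp add: offer_val_def)
        show ?thesis
          unfolding v unfolding Some owner_val_def option.case Suc o
          apply (rule steps_cong, (rule steps_If_True steps_rules val.distinct)+)
          apply (use False Some in simp_all)
          done
      qed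
    qed
  qed
  then have "steps m B (Output p) u (vlist (?enc (?os N))) (n + 100 * N + 100)"
    by (rule steps_cong) simp_all
  moreover have "set (?os N) = {(i, nat k) | i k. own k = Some i \<and> 0 \<le> k}"
    using own by force
  moreover have "length (?os N) \<le> N"
    by simp
  ultimately show ?thesis by blast
qed

lemma steps_Solve:
  "\<exists>own os. certified (offer_cost X C) (set (offer_columns X)) (tasks X) own \<and>
     set os = {(i, nat k) | i k. own k = Some i \<and> 0 \<le> k} \<and> length os \<le> N \<and>
     steps m B (Solve pC pP) (enc_instance (X, d)) (vlist (map (\<lambda>(i, j). vlist [vnat i, vnat j, VNum (C i j)]) os))
       (N * (N * (nC + nP + 400) + 2000 * (N + 1) ^ 3 + 700) + 700)"
proof -
  let ?ts = "sorted_list_of_set (tasks X)"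
  let ?vs = "map (task_val X) ?ts"
  let ?cols = "vlist (map (\<lambda>k. VNum (of_int k)) (offer_columns X))"
  let ?env = "VPair ?cols (VPair (enc_instance (X, d)) VNil)"
  let ?main = "Fold (hd_of V1) (Map V0 (Fork V0 (Basic Empty))) (Seq (Fork (Edges pC pP) (Basic Tail)) Insert)"
  let ?n = "N * (nC + nP + 400) + 2000 * (N + 1) ^ 3 + 200"
  let ?J = "\<lambda>l w. \<exists>own. w = matching_val own \<and> certified (offer_cost X C) (set (offer_columns X)) (set (take l ?ts)) own"
  have ts: "set ?ts = tasks X" "distinct ?ts" "length ?ts \<le> N"
    using fin by (simp_all add: length_offer_columns)
  have "\<exists>w. steps m B ?main ?env w (10 + (N * 100 + 100) + length ?vs * (?n + 20) + 20) \<and> ?J (length ?vs) w"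
  proof (rule steps_Fold_ex)
    show "steps m B (hd_of V1) ?env (vlist ?vs) 10"
      unfolding enc_instance_eq by (rule steps_weaken, (rule steps_rules)+) simp
    show "steps m B (Map V0 (Fork V0 (Basic Empty))) ?env (matching_val Map.empty) (N * 100 + 100)"
      apply (rule steps_cong, rule steps_Map, rule steps_rules)
      apply ((rule steps_rules)+)
      apply (simp_all add: matching_val_def owner_val_def)
      done
    show "?J 0 (matching_val Map.empty)"
      using certified_empty[of "offer_cost X C" "set (offer_columns X)"] by auto
    fix l w assume l: "l < length ?vs" and "?J l w"
    then obtain own where w: "w = matching_val own"
      and cert: "certified (offer_cost X C) (set (offer_columns X)) (set (take l ?ts)) own" by blast
    let ?i = "?ts ! l"
    have i: "?i \<in> tasks X" using l ts(1) nth_mem[of l ?ts] by simp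
    have take: "take (Suc l) ?ts = take l ?ts @ [?i]"
      using l by (simp add: take_Suc_conv_app_nth)
    then have ins: "insert ?i (set (take l ?ts)) = set (take (Suc l) ?ts)"
      by simp
    have "distinct (take (Suc l) ?ts)" using ts(2) by (rule distinct_take)
    then have new: "?i \<notin> set (take l ?ts)"
      unfolding take by simp
    have "insert ?i (set (take l ?ts)) \<subseteq> tasks X"
      using ts(1) ins by (metis set_take_subset)
    \<comment> \<open>There are at least as many columns as tasks, one professional driver per task,
      so that an insertion always finds a free column.\<close>
    moreover have "card (set (take l ?ts)) < N"
      using l ts(3) card_length[of "take l ?ts"] by simp
    ultimately obtain own' where cert': "certified (offer_cost X C) (set (offer_columns X)) (set (take (Suc l) ?ts)) own'"
      and run: "steps m B Insert (VPair (row_val ?i) (VPair (matching_val own) ?env)) (matching_val own') (2000 * (N + 1) ^ 3)"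
      using steps_Insert[OF cert new] unfolding ins by blast
    have v: "?vs ! l = task_val X ?i" using l by simp
    have "steps m B (Seq (Fork (Edges pC pP) (Basic Tail)) Insert) (VPair (?vs ! l) (VPair w ?env)) (matching_val own') ?n"
      unfolding v w
      by (rule steps_weaken, (rule steps_Seq steps_Fork steps_Edges[OF i] steps_Tail run)+) simp
    with cert' show "\<exists>w'. steps m B (Seq (Fork (Edges pC pP) (Basic Tail)) Insert) (VPair (?vs ! l) (VPair w ?env)) w' ?n \<and> ?J (Suc l) w'"
      by blast
  qed
  then obtain own where cert: "certified (offer_cost X C) (set (offer_columns X)) (tasks X) own"
    and "steps m B ?main ?env (matching_val own) (10 + (N * 100 + 100) + length ?vs * (?n + 20) + 20)"
    using ts(1) by auto
  moreover have "10 + (N * 100 + 100) + length ?vs * (?n + 20) + 20 \<le> N * (?n + 120) + 130"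
    using mult_le_mono1[OF ts(3), of "?n + 20"] by (simp add: distrib_left)
  ultimately have main: "steps m B ?main ?env (matching_val own) (N * (?n + 120) + 130)"
    using steps_weaken by blast
  have "dom own \<subseteq> set (offer_columns X)"
    using cert by (simp add: certified_def owners_def)
  from steps_Output[OF this main] obtain os where os: "set os = {(i, nat k) | i k. own k = Some i \<and> 0 \<le> k}" "length os \<le> N"
    and out: "steps m B (Output ?main) ?env (vlist (map (\<lambda>(i, j). vlist [vnat i, vnat j, VNum (C i j)]) os))
      (N * (?n + 120) + 130 + 100 * N + 100)" by blast
  have "steps m B (Solve pC pP) (enc_instance (X, d)) (vlist (map (\<lambda>(i, j). vlist [vnat i, vnat j, VNum (C i j)]) os))
      (N * (N * (nC + nP + 400) + 2000 * (N + 1) ^ 3 + 700) + 700)"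
    unfolding Solve_def
    by (rule steps_weaken, (rule steps_Seq steps_Fork steps_Copy steps_Empty steps_Columns out)+)
      (simp add: distrib_left)
  with cert os show ?thesis by blast
qed

end

section \<open>Polynomial bounds\<close>

text \<open>Allows the final bound to be recognised as a polynomial by introduction rules, without
  writing down its coefficients.\<close>

definition is_poly :: "(nat \<Rightarrow> nat) \<Rightarrow> bool" where
  "is_poly f \<longleftrightarrow> (\<exists>b :: nat poly. \<forall>n. f n = poly b n)"

lemma is_poly_intros:
  "is_poly (\<lambda>n. n)" "is_poly (\<lambda>n. c)"
  "is_poly f \<Longrightarrow> is_poly g \<Longrightarrow> is_poly (\<lambda>n. f n + g n)"
  "is_poly f \<Longrightarrow> is_poly g \<Longrightarrow> is_poly (\<lambda>n. f n * g n)"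
  "is_poly f \<Longrightarrow> is_poly (\<lambda>n. f n ^ k)"
  "is_poly f \<Longrightarrow> is_poly (\<lambda>n. poly b (f n))"
proof -
  show "is_poly (\<lambda>n. n)" unfolding is_poly_def by (rule exI[of _ "[:0, 1:]"]) simp
  show "is_poly (\<lambda>n. c)" unfolding is_poly_def by (rule exI[of _ "[:c:]"]) simp
  show "is_poly f \<Longrightarrow> is_poly g \<Longrightarrow> is_poly (\<lambda>n. f n + g n)"
    "is_poly f \<Longrightarrow> is_poly g \<Longrightarrow> is_poly (\<lambda>n. f n * g n)"
    "is_poly f \<Longrightarrow> is_poly (\<lambda>n. f n ^ k)" "is_poly f \<Longrightarrow> is_poly (\<lambda>n. poly b (f n))"
    unfolding is_poly_def by (metis poly_add, metis poly_mult, metis poly_power, metis poly_pcompose)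
qed

text \<open>Natural coefficients make the given time bounds monotone, so they can be applied to mere
  upper bounds on the sizes of the subprogram inputs.\<close>

lemma poly_nat_mono: "x \<le> y \<Longrightarrow> poly b x \<le> poly (b :: nat poly) y"
  by (induction b) (auto intro: add_mono mult_mono)

lemma val_numbers_vlist [simp]: "val_numbers (vlist vs) = (\<Union>v\<in>set vs. val_numbers v)"
  by (induction vs) auto

lemma number_size_less_val_size: "x \<in> val_numbers v \<Longrightarrow> number_size m x < val_size m v"
  by (induction v) auto

lemma length_less_val_size: "length vs < val_size m (vlist vs)"
  by (induction vs) auto

section \<open>Sizes of encoded instances and solutions\<close>

lemma enc_instance_numbers:
  assumes "capcab_instance X"
  shows "i \<in> tasks X \<Longrightarrow> real i \<in> val_numbers (enc_instance (X, d))"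
    "i \<in> tasks X \<Longrightarrow> cost X i \<in> val_numbers (enc_instance (X, d))"
    "i \<in> tasks X \<Longrightarrow> penalized_cost X i \<in> val_numbers (enc_instance (X, d))"
    "j \<in> drivers X \<Longrightarrow> real j \<in> val_numbers (enc_instance (X, d))"
  using assms by (auto simp: enc_instance_eq task_val_def capcab_instance_def)

lemma card_le_val_size_enc_instance:
  "card (tasks X) + card (drivers X) \<le> val_size m (enc_instance (X, d))"
  using length_less_val_size[of "map (task_val X) (sorted_list_of_set (tasks X))" m]
    length_less_val_size[of "map vnat (sorted_list_of_set (drivers X))" m]
  by (simp add: enc_instance_eq)

lemma val_size_offers:
  assumes "bounded m B (vlist (map (\<lambda>(i, j). vlist [vnat i, vnat j, VNum (C i j)]) os))"
  shows "val_size m (vlist (map (\<lambda>(i, j). vlist [vnat i, vnat j, VNum (C i j)]) os)) \<le> length os * (3 * B + 10) + 1"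
  using assms by (induction os) auto

theorem corollary2:
  fixes m :: cost_model and K :: "(capcab \<times> val) set"
  assumes "instance_class m K"
    and "acceptance_poly_time m K"
    and "\<And>X d. (X, d) \<in> K \<Longrightarrow> separable X"
    and "optimal_compensations_poly_time m K"
  shows "capcab_poly_time m K"
proof -
  obtain pC bC where pC: "\<And>X d i j. (X, d) \<in> K \<Longrightarrow> i \<in> tasks X \<Longrightarrow> j \<in> drivers X \<Longrightarrow>
    \<exists>x t. runs m pC (vlist [enc_instance (X, d), vnat i, vnat j]) (VNum x) t \<and>
      t + val_size m (VNum x) \<le> poly bC (val_size m (vlist [enc_instance (X, d), vnat i, vnat j])) \<and>
      optimal_compensation X i j x"
    using assms(4) unfolding optimal_compensations_poly_time_def poly_time_def by fastforce
  obtain pP bP where pP: "\<And>X d i j x. (X, d) \<in> K \<Longrightarrow> i \<in> tasks X \<Longrightarrow> j \<in> drivers X \<Longrightarrow>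
    x \<in> numbers m \<Longrightarrow> optimal_compensation X i j x \<Longrightarrow>
    \<exists>t. runs m pP (vlist [enc_instance (X, d), vnat i, vnat j, VNum x]) (VNum (acceptance X i j x)) t \<and>
      t + val_size m (VNum (acceptance X i j x)) \<le>
        poly bP (val_size m (vlist [enc_instance (X, d), vnat i, vnat j, VNum x]))"
    using assms(2) unfolding acceptance_poly_time_def poly_time_def by fastforce
  \<comment> \<open>An input of \<open>pC\<close> contains the instance of size \<open>n\<close> and
    two identifiers of size below \<open>n\<close>; an input of \<open>pP\<close> contains in
    addition a compensation of size below \<open>nC n\<close>. \<open>s\<close> dominates the sizes
    of all these numbers, of the probabilities and of 1.\<close>
  define nC where "nC n = poly bC (3 * n + 10)" for n
  define nP where "nP n = poly bP (4 * n + nC n + 10)" for n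
  define s where "s n = n + nC n + nP n + 3" for n
  define B where "B n = 30 * s n * (n + 1) + 2" for n
  define S where "S n = n * (n * (nC n + nP n + 400) + 2000 * (n + 1) ^ 3 + 700) + 700" for n
  have "is_poly (\<lambda>n. S n * (4 * B n + 1) + (n * (3 * B n + 10) + 1))"
    unfolding S_def B_def s_def nP_def nC_def by (intro is_poly_intros)
  then obtain b where b: "S n * (4 * B n + 1) + (n * (3 * B n + 10) + 1) = poly b n" for n
    unfolding is_poly_def by blast
  have "\<exists>w t. runs m (Solve pC pP) (enc_instance (X, d)) w t \<and>
      t + val_size m w \<le> poly b (val_size m (enc_instance (X, d))) \<and>
      (\<exists>A C. encodes_solution w A C \<and> optimal X A C)" if K: "(X, d) \<in> K" for X d
  proof -
    let ?e = "enc_instance (X, d)"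
    define n where "n = val_size m ?e"
    have X: "capcab_instance X" and num: "val_numbers ?e \<subseteq> numbers m"
      using assms(1) K by (auto simp: instance_class_def)
    have sep: "separable X" using assms(3) K .
    have size: "number_size m x < n" if "x \<in> val_numbers ?e" for x
      unfolding n_def using number_size_less_val_size[OF that] .
    have N: "length (offer_columns X) \<le> n"
      unfolding n_def length_offer_columns by (rule card_le_val_size_enc_instance)
    \<comment> \<open>The outputs of \<open>pC\<close> are gathered by choice into one compensation
      function, to which the whole optimality argument refers.\<close>
    obtain C where C: "\<exists>t. runs m pC (vlist [?e, vnat i, vnat j]) (VNum (C i j)) t \<and>
        t + val_size m (VNum (C i j)) \<le> poly bC (val_size m (vlist [?e, vnat i, vnat j])) \<and>
        optimal_compensation X i j (C i j)" if "i \<in> tasks X" "j \<in> drivers X" for i j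
      using pC[OF K] by metis
    have ij: "number_size m (real i) < n" "number_size m (real j) < n"
        "val_numbers (vlist [?e, vnat i, vnat j]) \<subseteq> numbers m"
      if "i \<in> tasks X" "j \<in> drivers X" for i j
      using size enc_instance_numbers[OF X] num that by auto
    have C': "\<exists>t. runs m pC (vlist [?e, vnat i, vnat j]) (VNum (C i j)) t \<and> t \<le> nC n"
        "number_size m (C i j) < nC n" "C i j \<in> numbers m" "optimal_compensation X i j (C i j)"
      if elem: "i \<in> tasks X" "j \<in> drivers X" for i j
    proof -
      obtain t where t: "runs m pC (vlist [?e, vnat i, vnat j]) (VNum (C i j)) t"
        "t + val_size m (VNum (C i j)) \<le> poly bC (val_size m (vlist [?e, vnat i, vnat j]))"
        and opt: "optimal_compensation X i j (C i j)"
        using C[OF elem] by blast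
      have "val_size m (vlist [?e, vnat i, vnat j]) \<le> 3 * n + 10"
        using ij[OF elem] by (simp add: n_def[symmetric])
      from poly_nat_mono[OF this, of bC] t
      show "\<exists>t. runs m pC (vlist [?e, vnat i, vnat j]) (VNum (C i j)) t \<and> t \<le> nC n" "number_size m (C i j) < nC n"
        by (auto simp: nC_def)
      show "C i j \<in> numbers m"
        using runs_numbers[OF t(1) ij(3)[OF elem]] by simp
      show "optimal_compensation X i j (C i j)" by (rule opt)
    qed
    have P: "\<exists>t. runs m pP (vlist [?e, vnat i, vnat j, VNum (C i j)]) (VNum (acceptance X i j (C i j))) t \<and> t \<le> nP n"
        "number_size m (acceptance X i j (C i j)) < nP n" "acceptance X i j (C i j) \<in> numbers m"
      if elem: "i \<in> tasks X" "j \<in> drivers X" for i j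
    proof -
      obtain t where t: "runs m pP (vlist [?e, vnat i, vnat j, VNum (C i j)]) (VNum (acceptance X i j (C i j))) t"
        "t + val_size m (VNum (acceptance X i j (C i j))) \<le> poly bP (val_size m (vlist [?e, vnat i, vnat j, VNum (C i j)]))"
        using pP[OF K elem C'(3,4)[OF elem]] by blast
      have "val_size m (vlist [?e, vnat i, vnat j, VNum (C i j)]) \<le> 4 * n + nC n + 10"
        using ij[OF elem] C'(2)[OF elem] by (simp add: n_def[symmetric])
      from poly_nat_mono[OF this, of bP] t
      show "\<exists>t. runs m pP (vlist [?e, vnat i, vnat j, VNum (C i j)]) (VNum (acceptance X i j (C i j))) t \<and> t \<le> nP n"
        "number_size m (acceptance X i j (C i j)) < nP n"
        by (auto simp: nP_def)
      have "val_numbers (vlist [?e, vnat i, vnat j, VNum (C i j)]) \<subseteq> numbers m"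
        using ij(3)[OF elem] C'(3)[OF elem] by simp
      from runs_numbers[OF t(1) this] show "acceptance X i j (C i j) \<in> numbers m"
        by simp
    qed
    have "s n * 1 \<le> 30 * s n * (n + 1)" by (simp add: mult_le_mono)
    then have s_le: "s n \<le> B n" by (simp add: B_def)
    have fits: "fits m (s n) 1 x" if "x \<in> numbers m" "number_size m x \<le> s n" for x
      using fits_of_size that .
    have fits_enc: "fits m (s n) 1 x" if "x \<in> val_numbers ?e" for x
      using num size[OF that] that by (intro fits) (auto simp: s_def)
    interpret solver m "B n" "s n" X d C pC pP "nC n" "nP n"
    proof
      show "capcab_instance X" by (rule X)
      fix i assume i: "i \<in> tasks X"
      show "fits m (s n) 1 (real i) \<and> fits m (s n) 1 (cost X i) \<and> fits m (s n) 1 (penalized_cost X i)"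
        using enc_instance_numbers(1-3)[OF X i, of d] fits_enc by blast
      fix j assume j: "j \<in> drivers X"
      show "steps m (B n) pC (vlist [?e, vnat i, vnat j]) (VNum (C i j)) (nC n)"
        using C'(1,2)[OF i j] s_le by (auto intro!: steps_runs simp: s_def)
      show "steps m (B n) pP (vlist [?e, vnat i, vnat j, VNum (C i j)]) (VNum (acceptance X i j (C i j))) (nP n)"
        using P(1,2)[OF i j] s_le by (auto intro!: steps_runs simp: s_def)
      show "fits m (s n) 1 (C i j) \<and> fits m (s n) 1 (acceptance X i j (C i j))"
        using C'(2,3)[OF i j] P(2,3)[OF i j] by (intro conjI fits) (simp_all add: s_def)
    next
      show "fits m (s n) 1 1"
        using of_int_numbers[of 1 m] by (intro fits order_trans[OF number_size_small(1)]) (simp_all add: s_def)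
      show "0 < s n" by (simp add: s_def)
      show "30 * s n * (length (offer_columns X) + 1) + 2 \<le> B n"
        using N by (simp add: B_def)
    qed
    obtain own os where cert: "certified (offer_cost X C) (set (offer_columns X)) (tasks X) own"
      and os: "set os = {(i, nat k) | i k. own k = Some i \<and> 0 \<le> k}" "length os \<le> N"
      and run: "steps m (B n) (Solve pC pP) ?e (vlist (map (\<lambda>(i, j). vlist [vnat i, vnat j, VNum (C i j)]) os))
       (N * (N * (nC n + nP n + 400) + 2000 * (N + 1) ^ 3 + 700) + 700)"
      using steps_Solve by blast
    let ?w = "vlist (map (\<lambda>(i, j). vlist [vnat i, vnat j, VNum (C i j)]) os)"
    have "N * (N * (nC n + nP n + 400) + 2000 * (N + 1) ^ 3 + 700) + 700 \<le> S n"
      unfolding S_def using N by (intro add_mono mult_mono power_mono) auto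
    note run' = steps_weaken[OF run this]
    have "bounded m (B n) ?e"
      using size s_le by (fastforce simp: bounded_def B_def s_def)
    with run' obtain t where t: "runs m (Solve pC pP) ?e ?w t" "t \<le> S n * (4 * B n + 1)" "bounded m (B n) ?w"
      unfolding steps_def by blast
    have "val_size m ?w \<le> length os * (3 * B n + 10) + 1"
      using val_size_offers[OF t(3)] .
    also have "\<dots> \<le> n * (3 * B n + 10) + 1"
      using os(2) N by (intro add_mono mult_mono) auto
    finally have "t + val_size m ?w \<le> poly b n"
      using t(2) b[of n] by linarith
    moreover have "optimal X (set os) C"
      unfolding os(1) using certified_offers_optimal[OF X sep C'(4) cert] by blast
    ultimately show ?thesis
      using t(1) unfolding n_def encodes_solution_def by blast
  qed
  then show ?thesis
    unfolding capcab_poly_time_def poly_time_def by (intro exI[of _ "Solve pC pP"] exI[of _ b]) auto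
qed

end
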